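(* Let $V$ and $W$ be analytic discs attached to the unit sphere, with embedding maps $f$ and $g$ respectively. If $\mathcal{M}_f = \mathcal{M}_g$ with equivalent norms, then for all $\xi,\zeta\in\mathbb{T}$ such that $f(\xi)=f(\zeta)$ (in which case also $g(\xi)=g(\zeta)$) we have $$\frac{A_f(\xi)}{A_f(\zeta)} = \frac{A_g(\xi)}{A_g(\zeta)}.$$
   Context: Notation: $\mathbb{D}$ is the open unit disc, $\mathbb{T}$ the unit circle, $\mathbb{B}_d$ the open Euclidean unit ball of $\mathbb{C}^d$, with $\langle z,w\rangle=\sum_j z_j\overline{w_j}$. The Drury-Arveson space $H^2_d$ is the reproducing kernel Hilbert space (RKHS) on $\mathbb{B}_d$ with kernel $\kappa_w(z)=\frac{1}{1-\langle z,w\rangle}$; $\mathcal{M}_d=\operatorname{Mult}(H^2_d)$ is its multiplier algebra. A variety in $\mathbb{B}_d$ is a set of the form $\{z\in\mathbb{B}_d:\varphi(z)=0\ \text{for all}\ \varphi\in E\}$ with $E\subset\mathcal{M}_d$. An analytic disc attached to the unit sphere is a variety $V\subset\mathbb{B}_d$, $d<\infty$, for which there exists an injective analytic map $f:\mathbb{D}\to\mathbb{B}_d$ with $f'(z)\neq 0$ for $z\in\mathbb{D}$, such that $V=f(\mathbb{D})$, $f$ extends to be $C^2$ up to $\overline{\mathbb{D}}$, and for $x\in\overline{\mathbb{D}}$, $\|f(x)\|=1\iff|x|=1$. Such an $f$ is called an embedding map of $V$; $f,f'$ also denote the extensions to $\overline{\mathbb{D}}$. For a variety $V$, $\mathcal{H}_V$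 is the closed linear span of $\{\kappa_\lambda:\lambda\in V\}$ in $H^2_d$, regarded as an RKHS of functions on $V$, and $\mathcal{M}_V=\{\varphi|_V:\varphi\in\mathcal{M}_d\}$, which equals $\operatorname{Mult}(\mathcal{H}_V)$ and carries the multiplier norm. If $f$ is an embedding map of $V$, then $\mathcal{M}_f=\{\varphi:\mathbb{D}\to\mathbb{C}:\ \varphi\circ f^{-1}\in\mathcal{M}_V\}$ with $\|\varphi\|_{\mathcal{M}_f}=\|\varphi\circ f^{-1}\|_{\mathcal{M}_V}$. For an embedding map $f$, $A_f(\xi)=\langle f(\xi),f'(\xi)\xi\rangle$ for $\xi\in\mathbb{T}$; it is known that $A_f(\xi)>0$ for all $\xi\in\mathbb{T}$. *)

theory Defs
  imports "HOL-Analysis.Analysis" "HOL-Library.Function_Algebras"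
begin

text \<open>
  Sums, differences and products of functions are the pointwise ones of
  \<^theory>\<open>HOL-Library.Function_Algebras\<close>. A complex-valued function on a set \<open>X\<close> is represented by
  the total function that vanishes outside \<open>X\<close>.
\<close>

global_interpretation cfun: vector_space "\<lambda>(c::complex) (h::'a \<Rightarrow> complex) x. c * h x"
  by unfold_locales (auto simp: fun_eq_iff algebra_simps)

definition restrict0 :: "'a set \<Rightarrow> ('a \<Rightarrow> complex) \<Rightarrow> 'a \<Rightarrow> complex" where
  "restrict0 X h = (\<lambda>x. if x \<in> X then h x else 0)"


section \<open>Hilbert spaces of functions and their multipliers\<close>

record 'a fun_space =
  space_carrier :: "('a \<Rightarrow> complex) set"
  inner_prod :: "('a \<Rightarrow> complex) \<Rightarrow> ('a \<Rightarrow> complex) \<Rightarrow> complex"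

definition space_norm :: "'a fun_space \<Rightarrow> ('a \<Rightarrow> complex) \<Rightarrow> real" where
  "space_norm H h = sqrt (Re (inner_prod H h h))"

definition hilbert_space_on :: "'a set \<Rightarrow> 'a fun_space \<Rightarrow> bool" where
  "hilbert_space_on X H \<longleftrightarrow>
     (\<forall>h\<in>space_carrier H. \<forall>x. x \<notin> X \<longrightarrow> h x = 0) \<and>
     cfun.subspace (space_carrier H) \<and>
     (\<forall>h\<in>space_carrier H. \<forall>k\<in>space_carrier H. \<forall>l\<in>space_carrier H. \<forall>c.
        inner_prod H (h + k) l = inner_prod H h l + inner_prod H k l \<and>
        inner_prod H (\<lambda>x. c * h x) l = c * inner_prod H h l \<and>
        inner_prod H l h = cnj (inner_prod H h l)) \<and>
     (\<forall>h\<in>space_carrier H. 0 \<le> Re (inner_prod H h h) \<and> (inner_prod H h h = 0 \<longrightarrow> h = 0)) \<and>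
     (\<forall>s. (\<forall>n. s n \<in> space_carrier H) \<and>
          (\<forall>e>0. \<exists>N. \<forall>m\<ge>N. \<forall>n\<ge>N. space_norm H (s m - s n) < e) \<longrightarrow>
          (\<exists>h\<in>space_carrier H. (\<lambda>n::nat. space_norm H (s n - h)) \<longlonglongrightarrow> 0))"

text \<open>In \<open>is_rkhs X K H\<close>, the kernel function at \<open>y\<close> is \<open>\<lambda>x. K y x\<close>.\<close>

definition is_rkhs :: "'a set \<Rightarrow> ('a \<Rightarrow> 'a \<Rightarrow> complex) \<Rightarrow> 'a fun_space \<Rightarrow> bool" where
  "is_rkhs X K H \<longleftrightarrow>
     hilbert_space_on X H \<and>
     (\<forall>y\<in>X. restrict0 X (K y) \<in> space_carrier H) \<and>
     (\<forall>h\<in>space_carrier H. \<forall>y\<in>X. inner_prod H h (restrict0 X (K y)) = h y)"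

text \<open>
  The RKHS with kernel \<open>K\<close> is unique; only the values of \<^const>\<open>inner_prod\<close> at
  arguments outside the carrier are left open by \<^const>\<open>is_rkhs\<close>, and these are never used.
\<close>

definition rkhs :: "'a set \<Rightarrow> ('a \<Rightarrow> 'a \<Rightarrow> complex) \<Rightarrow> 'a fun_space" where
  "rkhs X K = (SOME H. is_rkhs X K H)"

definition Mult :: "'a set \<Rightarrow> 'a fun_space \<Rightarrow> ('a \<Rightarrow> complex) set" where
  "Mult X H = {\<phi>. (\<forall>x. x \<notin> X \<longrightarrow> \<phi> x = 0) \<and> (\<forall>h\<in>space_carrier H. \<phi> * h \<in> space_carrier H)}"

text \<open>
  The operator norm of multiplication by \<open>\<phi>\<close>. It is finite for every multiplier
  of an RKHS, by the closed graph theorem.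
\<close>

definition mult_norm :: "'a fun_space \<Rightarrow> ('a \<Rightarrow> complex) \<Rightarrow> ennreal" where
  "mult_norm H \<phi> =
     (SUP h\<in>{h \<in> space_carrier H. space_norm H h \<le> 1}. ennreal (space_norm H (\<phi> * h)))"

definition closed_span :: "'a fun_space \<Rightarrow> ('a \<Rightarrow> complex) set \<Rightarrow> ('a \<Rightarrow> complex) set" where
  "closed_span H S =
     {h \<in> space_carrier H. \<forall>e>0. \<exists>k\<in>cfun.span S. space_norm H (h - k) < e}"


section \<open>The Drury-Arveson space and varieties\<close>

definition cinner :: "complex ^ 'n \<Rightarrow> complex ^ 'n \<Rightarrow> complex" where
  "cinner z w = (\<Sum>j\<in>UNIV. z $ j * cnj (w $ j))"

definition da_kernel :: "complex ^ 'n \<Rightarrow> complex ^ 'n \<Rightarrow> complex" where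
  "da_kernel w z = 1 / (1 - cinner z w)"

definition drury_arveson :: "(complex ^ 'n) fun_space" where
  "drury_arveson = rkhs (ball 0 1) da_kernel"

definition da_multipliers :: "(complex ^ 'n \<Rightarrow> complex) set" where
  "da_multipliers = Mult (ball 0 1) drury_arveson"

definition variety :: "(complex ^ 'n) set \<Rightarrow> bool" where
  "variety V \<longleftrightarrow> (\<exists>E \<subseteq> da_multipliers. V = {z \<in> ball 0 1. \<forall>\<phi>\<in>E. \<phi> z = 0})"

definition kernel_span :: "(complex ^ 'n) set \<Rightarrow> (complex ^ 'n \<Rightarrow> complex) set" where
  "kernel_span V = closed_span drury_arveson ((\<lambda>v. restrict0 (ball 0 1) (da_kernel v)) ` V)"

text \<open>
  The closed span as a space of functions on \<open>V\<close>. Restriction to \<open>V\<close> is injective on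
  \<^term>\<open>kernel_span V\<close>, and the inner product is transported along it.
\<close>

definition variety_space :: "(complex ^ 'n) set \<Rightarrow> (complex ^ 'n) fun_space" where
  "variety_space V =
     \<lparr> space_carrier = restrict0 V ` kernel_span V,
       inner_prod = (\<lambda>u v. inner_prod drury_arveson
          (inv_into (kernel_span V) (restrict0 V) u) (inv_into (kernel_span V) (restrict0 V) v)) \<rparr>"

definition variety_multipliers :: "(complex ^ 'n) set \<Rightarrow> (complex ^ 'n \<Rightarrow> complex) set" where
  "variety_multipliers V = restrict0 V ` da_multipliers"


section \<open>Analytic discs attached to the unit sphere\<close>

text \<open>
  An embedding map is a total function whose values on the closed disc are those of the continuous
  extension; its values elsewhere are irrelevant. Its derivative on the closed disc is
  the continuous extension of the complex derivative on the open disc, whence the limit.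
\<close>

definition disc_deriv :: "(complex \<Rightarrow> complex ^ 'n) \<Rightarrow> complex \<Rightarrow> complex ^ 'n" where
  "disc_deriv f x = (\<chi> j. Lim (at x within ball 0 1) (deriv (\<lambda>z. f z $ j)))"

text \<open>
  For a map that is holomorphic on the open disc, being \<open>C\<^sup>2\<close> up to the boundary means that the
  map and its first two complex derivatives extend continuously to the closed disc.
\<close>

definition C2_closed_disc :: "(complex \<Rightarrow> complex ^ 'n) \<Rightarrow> bool" where
  "C2_closed_disc f \<longleftrightarrow>
     continuous_on (cball 0 1) f \<and>
     (\<forall>j. \<forall>k\<in>{1, 2}. \<exists>g. continuous_on (cball 0 1) g \<and>
        (\<forall>z\<in>ball 0 1. g z = (deriv ^^ k) (\<lambda>w. f w $ j) z))"

definition disc_embedding :: "(complex ^ 'n) set \<Rightarrow> (complex \<Rightarrow> complex ^ 'n) \<Rightarrow> bool" where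
  "disc_embedding V f \<longleftrightarrow>
     (\<forall>j. (\<lambda>z. f z $ j) holomorphic_on ball 0 1) \<and>
     f ` ball 0 1 \<subseteq> ball 0 1 \<and>
     inj_on f (ball 0 1) \<and>
     (\<forall>z\<in>ball 0 1. disc_deriv f z \<noteq> 0) \<and>
     V = f ` ball 0 1 \<and>
     C2_closed_disc f \<and>
     (\<forall>x\<in>cball 0 1. norm (f x) = 1 \<longleftrightarrow> norm x = 1)"

definition analytic_disc :: "(complex ^ 'n) set \<Rightarrow> bool" where
  "analytic_disc V \<longleftrightarrow> variety V \<and> (\<exists>f. disc_embedding V f)"

definition compose_inverse ::
  "(complex \<Rightarrow> complex ^ 'n) \<Rightarrow> (complex \<Rightarrow> complex) \<Rightarrow> complex ^ 'n \<Rightarrow> complex" where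
  "compose_inverse f \<phi> = restrict0 (f ` ball 0 1) (\<phi> \<circ> inv_into (ball 0 1) f)"

definition disc_multipliers :: "(complex \<Rightarrow> complex ^ 'n) \<Rightarrow> (complex \<Rightarrow> complex) set" where
  "disc_multipliers f =
     {\<phi>. (\<forall>x. x \<notin> ball 0 1 \<longrightarrow> \<phi> x = 0) \<and>
          compose_inverse f \<phi> \<in> variety_multipliers (f ` ball 0 1)}"

definition disc_mult_norm ::
  "(complex \<Rightarrow> complex ^ 'n) \<Rightarrow> (complex \<Rightarrow> complex) \<Rightarrow> ennreal" where
  "disc_mult_norm f \<phi> = mult_norm (variety_space (f ` ball 0 1)) (compose_inverse f \<phi>)"

definition equal_with_equivalent_norms ::
  "(complex \<Rightarrow> complex ^ 'm) \<Rightarrow> (complex \<Rightarrow> complex ^ 'n) \<Rightarrow> bool" where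
  "equal_with_equivalent_norms f g \<longleftrightarrow>
     disc_multipliers f = disc_multipliers g \<and>
     (\<exists>c>0. \<exists>C>0. \<forall>\<phi>\<in>disc_multipliers f.
        ennreal c * disc_mult_norm f \<phi> \<le> disc_mult_norm g \<phi> \<and>
        disc_mult_norm g \<phi> \<le> ennreal C * disc_mult_norm f \<phi>)"

definition A_coeff :: "(complex \<Rightarrow> complex ^ 'n) \<Rightarrow> complex \<Rightarrow> complex" where
  "A_coeff f \<xi> = cinner (f \<xi>) (\<xi> *s disc_deriv f \<xi>)"

end

theory Submission
  imports Defs "HOL-Complex_Analysis.Conformal_Mappings"
begin

text \<open>
  Let \<open>f \<xi> = f \<zeta>\<close> and approach \<open>\<xi>\<close> and \<open>\<zeta>\<close> along the radii, through
  \<open>z s = (1 - s) * \<xi>\<close> and \<open>w s = (1 - c * s) * \<zeta>\<close>. To first order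
  \<open>1 - (norm (f (z s)))\<^sup>2\<close>, \<open>1 - (norm (f (w s)))\<^sup>2\<close> and
  \<open>1 - cinner (f (z s)) (f (w s))\<close> are \<open>s\<close> times \<open>2 * A\<close>, \<open>2 * c * A'\<close> and
  \<open>A + c * A'\<close>, where \<open>A\<close> and \<open>A'\<close> are the coefficients of \<open>f\<close> at \<open>\<xi>\<close> and
  \<open>\<zeta>\<close> (\<open>radial_expansion\<close>). For \<open>c = A / A'\<close> the angle between the kernel functions
  at \<open>f (z s)\<close> and \<open>f (w s)\<close> therefore tends to zero (\<open>kernel_cos2_tendsto_1\<close>). A
  multiplier cannot tell apart two points whose kernel functions are nearly parallel
  (\<open>multiplier_variation\<close>), so a family that is bounded in the multiplier norm of \<open>f\<close>
  takes asymptotically equal values at \<open>z s\<close> and \<open>w s\<close>. By the equivalence of the norms the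
  same is true of every family that is bounded in the multiplier norm of \<open>g\<close>.

  It remains to find a bounded family for \<open>g\<close> that sees the first-order behaviour of \<open>g\<close> at
  the circle. With \<open>q = g \<xi>\<close>, multiplication by \<open>cinner x q\<close> is a contraction on the
  Drury-Arveson space, hence so is multiplication by \<open>s\<close> times the resolvent,
  \<open>s / (1 + s - cinner x q)\<close>, for every \<open>s > 0\<close>
  (\<open>resolvent_multiplier_contraction\<close>). Its value at \<open>g (z s)\<close> tends to
  \<open>1 / (1 + B)\<close>. At \<open>g (w s)\<close> it tends to \<open>0\<close> if \<open>g \<xi> \<noteq> g \<zeta>\<close>, and to
  \<open>1 / (1 + c * B')\<close> otherwise, where \<open>B\<close> and \<open>B'\<close> are the coefficients of \<open>g\<close>.
  Since the two limits agree, \<open>g \<xi> = g \<zeta>\<close> and \<open>B = c * B'\<close>, which is the claim.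

  The coefficients are real because \<open>f\<close> maps the circle into the sphere
  (\<open>A_coeff_real\<close>), and the Schwarz lemma makes them positive (\<open>A_coeff_pos\<close>), so the
  quotients make sense and no limit above degenerates.

  The Drury-Arveson space is defined by its kernel alone. It is realised here as a quotient of the
  full Fock space: the kernel is the sum over all words of the products of word monomials, a
  function is represented by square-summable coefficients indexed by words, and the resolvent acts
  on coefficients by a recursion on words whose contractivity is the convexity of the square. The
  uniqueness of reproducing kernel Hilbert spaces (\<open>rkhs_unique\<close>) carries the estimate to
  the space of the definition.
\<close>

section \<open>Hilbert spaces of functions and orthogonal projection\<close>

locale hilbert_functions =
  fixes X :: "'a set" and H :: "'a fun_space"
  assumes hilbert: "hilbert_space_on X H"
begin

lemmas hilbert_axioms = hilbert[unfolded hilbert_space_on_def]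

lemma subspace_carrier: "cfun.subspace (space_carrier H)"
  using hilbert_axioms by blast

lemma zero_in [simp]: "0 \<in> space_carrier H"
  using cfun.subspace_0[OF subspace_carrier] .

lemma add_in [simp]: "h \<in> space_carrier H \<Longrightarrow> k \<in> space_carrier H \<Longrightarrow> h + k \<in> space_carrier H"
  using cfun.subspace_add[OF subspace_carrier] .

lemma diff_in [simp]: "h \<in> space_carrier H \<Longrightarrow> k \<in> space_carrier H \<Longrightarrow> h - k \<in> space_carrier H"
  using cfun.subspace_diff[OF subspace_carrier] .

lemma scale_in [simp]: "h \<in> space_carrier H \<Longrightarrow> (\<lambda>x. c * h x) \<in> space_carrier H"
  using cfun.subspace_scale[OF subspace_carrier] .

lemma span_in: "S \<subseteq> space_carrier H \<Longrightarrow> cfun.span S \<subseteq> space_carrier H"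
  using cfun.span_minimal[OF _ subspace_carrier] .

lemma vanishes_outside: "h \<in> space_carrier H \<Longrightarrow> x \<notin> X \<Longrightarrow> h x = 0"
  using conjunct1[OF hilbert_axioms] by blast

lemma inner_add_left:
  "h \<in> space_carrier H \<Longrightarrow> k \<in> space_carrier H \<Longrightarrow> l \<in> space_carrier H \<Longrightarrow>
    inner_prod H (h + k) l = inner_prod H h l + inner_prod H k l"
  using hilbert_axioms by blast

lemma inner_scale_left:
  "h \<in> space_carrier H \<Longrightarrow> l \<in> space_carrier H \<Longrightarrow>
    inner_prod H (\<lambda>x. c * h x) l = c * inner_prod H h l"
  using hilbert_axioms by blast

lemma inner_commute:
  "h \<in> space_carrier H \<Longrightarrow> l \<in> space_carrier H \<Longrightarrow> inner_prod H l h = cnj (inner_prod H h l)"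
  using hilbert_axioms by blast

lemma inner_diff_left:
  assumes "h \<in> space_carrier H" "k \<in> space_carrier H" "l \<in> space_carrier H"
  shows "inner_prod H (h - k) l = inner_prod H h l - inner_prod H k l"
  using inner_add_left[of "h - k" k l] assms by simp

lemma inner_add_right:
  assumes "h \<in> space_carrier H" "k \<in> space_carrier H" "l \<in> space_carrier H"
  shows "inner_prod H l (h + k) = inner_prod H l h + inner_prod H l k"
  using assms inner_commute[of "h + k" l] inner_commute[of h l] inner_commute[of k l]
  by (simp add: inner_add_left)

lemma inner_scale_right:
  assumes "h \<in> space_carrier H" "l \<in> space_carrier H"
  shows "inner_prod H l (\<lambda>x. c * h x) = cnj c * inner_prod H l h"
  using assms inner_commute[of "\<lambda>x. c * h x" l] inner_commute[of h l]
  by (simp add: inner_scale_left)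

lemma inner_diff_right:
  assumes "h \<in> space_carrier H" "k \<in> space_carrier H" "l \<in> space_carrier H"
  shows "inner_prod H l (h - k) = inner_prod H l h - inner_prod H l k"
  using inner_add_right[of "h - k" k l] assms by simp

lemma norm_ge_0 [simp]: "h \<in> space_carrier H \<Longrightarrow> 0 \<le> space_norm H h"
  unfolding space_norm_def real_sqrt_ge_0_iff using hilbert_axioms by blast

lemma inner_self:
  assumes "h \<in> space_carrier H"
  shows "inner_prod H h h = of_real ((space_norm H h)\<^sup>2)"
proof -
  have "0 \<le> Re (inner_prod H h h)"
    using hilbert_axioms assms by blast
  moreover have "Im (inner_prod H h h) = 0"
    using arg_cong[OF inner_commute[OF assms assms], of Im] by simp
  ultimately show ?thesis
    by (simp add: space_norm_def complex_eq_iff)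
qed

lemma norm_eq_0: "h \<in> space_carrier H \<Longrightarrow> space_norm H h = 0 \<Longrightarrow> h = 0"
  using hilbert_axioms inner_self[of h] by (metis of_real_0 zero_power2)

lemma norm_zero [simp]: "space_norm H 0 = 0"
proof -
  have "inner_prod H 0 0 = inner_prod H 0 0 + inner_prod H 0 0"
    using inner_add_left[of 0 0 0] by simp
  then show ?thesis by (simp add: space_norm_def)
qed

lemma complete:
  assumes "\<And>n. s n \<in> space_carrier H"
    and "\<And>e. e > 0 \<Longrightarrow> \<exists>N. \<forall>m\<ge>N. \<forall>n\<ge>N. space_norm H (s m - s n) < e"
  obtains h where "h \<in> space_carrier H" "(\<lambda>n::nat. space_norm H (s n - h)) \<longlonglongrightarrow> 0"
proof -
  have "\<exists>h\<in>space_carrier H. (\<lambda>n. space_norm H (s n - h)) \<longlonglongrightarrow> 0"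
    using hilbert_axioms assms by blast
  then show thesis
    using that by blast
qed

lemma norm_scale:
  assumes "h \<in> space_carrier H"
  shows "space_norm H (\<lambda>x. c * h x) = cmod c * space_norm H h"
proof -
  have "of_real ((space_norm H (\<lambda>x. c * h x))\<^sup>2) = c * cnj c * inner_prod H h h"
    using assms inner_self[of "\<lambda>x. c * h x", symmetric]
    by (simp add: inner_scale_left inner_scale_right)
  also have "\<dots> = of_real ((cmod c * space_norm H h)\<^sup>2)"
    using assms by (simp only: complex_norm_square[symmetric] inner_self of_real_mult[symmetric] power_mult_distrib)
  finally have "(space_norm H (\<lambda>x. c * h x))\<^sup>2 = (cmod c * space_norm H h)\<^sup>2"
    using of_real_eq_iff by blast
  then show ?thesis
    using assms by (simp add: power2_eq_iff_nonneg)
qed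

lemma norm_minus_commute:
  assumes "h \<in> space_carrier H" "k \<in> space_carrier H"
  shows "space_norm H (h - k) = space_norm H (k - h)"
proof -
  have "k - h = (\<lambda>x. (- 1) * (h - k) x)"
    by (auto simp: fun_eq_iff)
  then show ?thesis
    using norm_scale[of "h - k" "- 1"] assms by simp
qed

lemma norm_sq_diff_scale:
  assumes "h \<in> space_carrier H" "k \<in> space_carrier H" "space_norm H k \<noteq> 0"
  defines "c \<equiv> inner_prod H h k / of_real ((space_norm H k)\<^sup>2)"
  shows "(space_norm H (h - (\<lambda>x. c * k x)))\<^sup>2 =
    (space_norm H h)\<^sup>2 - (cmod (inner_prod H h k))\<^sup>2 / (space_norm H k)\<^sup>2"
proof -
  let ?p = "inner_prod H h k" and ?n = "complex_of_real ((space_norm H k)\<^sup>2)"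
  have n: "?n \<noteq> 0"
    using assms by simp
  have kh: "inner_prod H k h = cnj ?p"
    using inner_commute[of h k] assms by simp
  have "of_real ((space_norm H (h - (\<lambda>x. c * k x)))\<^sup>2) =
      inner_prod H h h - c * inner_prod H k h - cnj c * ?p + c * cnj c * inner_prod H k k"
    using assms(1,2) inner_self[of "h - (\<lambda>x. c * k x)", symmetric]
    by (simp add: inner_diff_left inner_diff_right inner_scale_left inner_scale_right right_diff_distrib)
  also have "\<dots> = inner_prod H h h - ?p * cnj ?p / ?n"
    unfolding kh inner_self[OF assms(2)] c_def using n by (simp add: field_simps)
  also have "\<dots> = of_real ((space_norm H h)\<^sup>2 - (cmod ?p)\<^sup>2 / (space_norm H k)\<^sup>2)"
    using inner_self[OF assms(1)] complex_norm_square[of ?p] by simp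
  finally show ?thesis
    using of_real_eq_iff by blast
qed

lemma Cauchy_Schwarz:
  assumes "h \<in> space_carrier H" "k \<in> space_carrier H"
  shows "cmod (inner_prod H h k) \<le> space_norm H h * space_norm H k"
proof (cases "space_norm H k = 0")
  case True
  then have "k = 0"
    using norm_eq_0 assms by blast
  then have "inner_prod H h k = 0"
    using inner_add_right[of 0 0 h] assms by simp
  then show ?thesis
    using True by simp
next
  case False
  have "0 \<le> (space_norm H h)\<^sup>2 - (cmod (inner_prod H h k))\<^sup>2 / (space_norm H k)\<^sup>2"
    using norm_sq_diff_scale[OF assms False] by (metis zero_le_power2)
  then have "(cmod (inner_prod H h k))\<^sup>2 \<le> (space_norm H h * space_norm H k)\<^sup>2"
    using False by (simp add: field_simps power_mult_distrib)
  then show ?thesis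
    by (rule power2_le_imp_le) (use assms in simp)
qed

lemma norm_triangle:
  assumes "h \<in> space_carrier H" "k \<in> space_carrier H"
  shows "space_norm H (h + k) \<le> space_norm H h + space_norm H k"
proof (rule power2_le_imp_le)
  have "of_real ((space_norm H (h + k))\<^sup>2) =
      inner_prod H h h + inner_prod H k k + (inner_prod H h k + cnj (inner_prod H h k))"
    using assms inner_self[of "h + k"] inner_commute[of h k]
    by (simp add: inner_add_left inner_add_right algebra_simps)
  also have "\<dots> = of_real ((space_norm H h)\<^sup>2 + (space_norm H k)\<^sup>2 + 2 * Re (inner_prod H h k))"
    using assms by (simp add: inner_self complex_add_cnj)
  finally have "(space_norm H (h + k))\<^sup>2 =
      (space_norm H h)\<^sup>2 + (space_norm H k)\<^sup>2 + 2 * Re (inner_prod H h k)"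
    using of_real_eq_iff by blast
  also have "\<dots> \<le> (space_norm H h)\<^sup>2 + (space_norm H k)\<^sup>2 + 2 * (space_norm H h * space_norm H k)"
    using Cauchy_Schwarz[OF assms] complex_Re_le_cmod[of "inner_prod H h k"] by linarith
  finally show "(space_norm H (h + k))\<^sup>2 \<le> (space_norm H h + space_norm H k)\<^sup>2"
    by (simp add: power2_sum)
qed (use assms in simp)

lemma norm_triangle_diff:
  assumes "h \<in> space_carrier H" "k \<in> space_carrier H" "l \<in> space_carrier H"
  shows "space_norm H (h - l) \<le> space_norm H (h - k) + space_norm H (l - k)"
  using norm_triangle[of "h - k" "k - l"] norm_minus_commute[of k l] assms by simp

lemma norm_diff_bound:
  assumes "h \<in> space_carrier H" "k \<in> space_carrier H"
  shows "\<bar>space_norm H h - space_norm H k\<bar> \<le> space_norm H (h - k)"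
  using norm_triangle[of "h - k" k] norm_triangle[of "k - h" h] norm_minus_commute[of k h] assms
  by auto

lemma tendsto_inner_left:
  assumes "\<And>n. s n \<in> space_carrier H" "h \<in> space_carrier H" "k \<in> space_carrier H"
    and "(\<lambda>n. space_norm H (s n - h)) \<longlonglongrightarrow> 0"
  shows "(\<lambda>n. inner_prod H (s n) k) \<longlonglongrightarrow> inner_prod H h k"
proof (rule LIM_zero_cancel, rule Lim_null_comparison)
  show "\<forall>\<^sub>F n in sequentially.
      cmod (inner_prod H (s n) k - inner_prod H h k) \<le> space_norm H (s n - h) * space_norm H k"
    using Cauchy_Schwarz[of "s n - h" k for n] assms by (simp add: inner_diff_left)
  show "(\<lambda>n. space_norm H (s n - h) * space_norm H k) \<longlonglongrightarrow> 0"
    using tendsto_mult_left_zero[OF assms(4)] .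
qed

lemma tendsto_norm:
  assumes "\<And>n. s n \<in> space_carrier H" "h \<in> space_carrier H"
    and "(\<lambda>n. space_norm H (s n - h)) \<longlonglongrightarrow> 0"
  shows "(\<lambda>n. space_norm H (s n)) \<longlonglongrightarrow> space_norm H h"
proof (rule LIM_zero_cancel, rule Lim_null_comparison)
  show "\<forall>\<^sub>F n in sequentially. norm (space_norm H (s n) - space_norm H h) \<le> space_norm H (s n - h)"
    using norm_diff_bound[of "s n" h for n] assms by simp
qed (use assms in simp)

lemma convergent_imp_Cauchy:
  assumes "\<And>n. s n \<in> space_carrier H" "h \<in> space_carrier H"
    and "(\<lambda>n::nat. space_norm H (s n - h)) \<longlonglongrightarrow> 0" "e > 0"
  shows "\<exists>N. \<forall>m\<ge>N. \<forall>n\<ge>N. space_norm H (s m - s n) < e"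
proof -
  obtain N where N: "\<And>n. n \<ge> N \<Longrightarrow> space_norm H (s n - h) < e / 2"
    using order_tendstoD(2)[OF assms(3), of "e / 2"] assms(4)
    by (auto simp: eventually_sequentially)
  have "space_norm H (s m - s n) < e" if "m \<ge> N" "n \<ge> N" for m n
    using norm_triangle_diff[of "s m" h "s n"] N[OF that(1)] N[OF that(2)] assms(1,2) by simp
  then show ?thesis by blast
qed

lemma closed_span_sequence:
  assumes "S \<subseteq> space_carrier H" "h \<in> closed_span H S"
  obtains s where "\<And>n. s n \<in> cfun.span S" "(\<lambda>n. space_norm H (s n - h)) \<longlonglongrightarrow> 0"
proof -
  have "\<exists>k\<in>cfun.span S. space_norm H (h - k) < inverse (real (Suc n))" for n
    using assms(2) by (simp add: closed_span_def)
  then obtain s where s: "\<And>n. s n \<in> cfun.span S" "\<And>n. space_norm H (h - s n) < inverse (real (Suc n))"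
    by metis
  have in_H: "h \<in> space_carrier H" "\<And>n. s n \<in> space_carrier H"
    using assms s(1) span_in[OF assms(1)] by (auto simp: closed_span_def)
  have "(\<lambda>n. space_norm H (s n - h)) \<longlonglongrightarrow> 0"
    by (rule tendsto_sandwich[OF _ _ tendsto_const LIMSEQ_inverse_real_of_nat])
       (use s(2) in_H norm_minus_commute in \<open>auto intro!: always_eventually less_imp_le\<close>)
  with s(1) show thesis by (rule that)
qed

text \<open>
  If \<open>s n\<close> almost attains the distance from \<open>h\<close> to the span, then \<open>h - s n\<close> is almost
  orthogonal to the span: subtracting its component along \<open>k\<close> cannot bring the norm below the
  distance, which bounds that component. Applied to \<open>k = s m - s n\<close>, the same bound shows that
  such a sequence is Cauchy; its limit is the projection.
\<close>

lemma orthogonal_projection: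
  assumes S: "S \<subseteq> space_carrier H" and h: "h \<in> space_carrier H"
  obtains p where "p \<in> closed_span H S" "\<And>k. k \<in> cfun.span S \<Longrightarrow> inner_prod H (h - p) k = 0"
    "space_norm H p \<le> space_norm H h" "space_norm H (h - p) \<le> space_norm H h"
proof -
  let ?T = "cfun.span S"
  define D where "D = (\<lambda>k. (space_norm H (h - k))\<^sup>2) ` ?T"
  define d where "d = Inf D"
  have T: "?T \<subseteq> space_carrier H"
    using span_in[OF S] .
  have bdd: "bdd_below D" and ne: "D \<noteq> {}"
    using cfun.span_zero[of S] by (auto simp: D_def intro!: bdd_belowI[of _ 0])
  have d_le: "d \<le> (space_norm H (h - k))\<^sup>2" if "k \<in> ?T" for k
    unfolding d_def using cInf_lower[OF _ bdd] that by (auto simp: D_def)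
  have "\<exists>k\<in>?T. (space_norm H (h - k))\<^sup>2 < d + (inverse (real (Suc n)))\<^sup>2" for n
    using cInf_lessD[OF ne, of "d + (inverse (real (Suc n)))\<^sup>2"] by (auto simp: D_def d_def)
  then obtain s where sT: "\<And>n. s n \<in> ?T"
    and s: "\<And>n. (space_norm H (h - s n))\<^sup>2 < d + (inverse (real (Suc n)))\<^sup>2"
    by metis
  note in_H = h subsetD[OF T sT]
  have almost: "cmod (inner_prod H (h - s n) k) \<le> inverse (real (Suc n)) * space_norm H k"
    if k: "k \<in> ?T" for n k
  proof (cases "space_norm H k = 0")
    case True
    then show ?thesis
      using Cauchy_Schwarz[of "h - s n" k] in_H T k by auto
  next
    case False
    let ?p = "inner_prod H (h - s n) k"
    let ?c = "?p / of_real ((space_norm H k)\<^sup>2)"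
    have kH: "k \<in> space_carrier H"
      using k T by blast
    have "h - (s n + (\<lambda>x. ?c * k x)) = h - s n - (\<lambda>x. ?c * k x)"
      by simp
    moreover have "s n + (\<lambda>x. ?c * k x) \<in> ?T"
      using cfun.span_add[OF sT cfun.span_scale[OF k]] .
    ultimately have "d \<le> (space_norm H (h - s n))\<^sup>2 - (cmod ?p)\<^sup>2 / (space_norm H k)\<^sup>2"
      using d_le norm_sq_diff_scale[OF _ kH False, of "h - s n"] in_H by (metis diff_in)
    then have "(cmod ?p)\<^sup>2 / (space_norm H k)\<^sup>2 \<le> (inverse (real (Suc n)))\<^sup>2"
      using s[of n] by linarith
    then have "(cmod ?p)\<^sup>2 \<le> (inverse (real (Suc n)) * space_norm H k)\<^sup>2"
      using False by (simp add: power_mult_distrib pos_divide_le_eq)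
    then show ?thesis
      by (rule power2_le_imp_le) (use kH in simp)
  qed
  have close: "space_norm H (s m - s n) \<le> inverse (real (Suc m)) + inverse (real (Suc n))" for m n
  proof (cases "space_norm H (s m - s n) = 0")
    case True
    then show ?thesis by simp
  next
    case False
    let ?k = "s m - s n"
    have kT: "?k \<in> ?T"
      using sT cfun.span_diff by blast
    have "?k = (h - s n) - (h - s m)"
      by simp
    then have "inner_prod H ?k ?k = inner_prod H (h - s n) ?k - inner_prod H (h - s m) ?k"
      using inner_diff_left[of "h - s n" "h - s m" ?k] in_H by auto
    then have "(space_norm H ?k)\<^sup>2 = cmod (inner_prod H (h - s n) ?k - inner_prod H (h - s m) ?k)"
      using arg_cong[OF inner_self[of ?k], of cmod] in_H by (simp only: norm_of_real diff_in) simp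
    also have "\<dots> \<le> (inverse (real (Suc m)) + inverse (real (Suc n))) * space_norm H ?k"
      using norm_triangle_ineq4[of "inner_prod H (h - s n) ?k" "inner_prod H (h - s m) ?k"]
        almost[OF kT, of n] almost[OF kT, of m] by (simp add: algebra_simps)
    finally show ?thesis
      using False norm_ge_0[OF diff_in[OF in_H(2) in_H(2)], of m n] unfolding power2_eq_square
      by (metis mult_right_le_imp_le less_eq_real_def)
  qed
  have "\<exists>N. \<forall>m\<ge>N. \<forall>n\<ge>N. space_norm H (s m - s n) < e" if "e > 0" for e
  proof -
    obtain N where N: "inverse (real (Suc N)) < e / 2"
      using reals_Archimedean[of "e / 2"] \<open>e > 0\<close> by auto
    have inv: "inverse (real (Suc n)) \<le> inverse (real (Suc N))" if "n \<ge> N" for n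
      using that by (simp add: le_imp_inverse_le)
    then have "space_norm H (s m - s n) < e" if "m \<ge> N" "n \<ge> N" for m n
      using close[of m n] N inv[OF that(1)] inv[OF that(2)] by linarith
    then show ?thesis by blast
  qed
  then obtain p where pH: "p \<in> space_carrier H" and lim: "(\<lambda>n. space_norm H (s n - p)) \<longlonglongrightarrow> 0"
    using complete[of s] in_H by blast
  have p: "p \<in> closed_span H S"
    unfolding closed_span_def
  proof (intro CollectI conjI allI impI pH)
    fix e :: real assume "e > 0"
    then obtain n where "space_norm H (s n - p) < e"
      using order_tendstoD(2)[OF lim] by (metis (mono_tags) eventually_sequentially order_refl)
    then show "\<exists>k\<in>?T. space_norm H (p - k) < e"
      using sT[of n] norm_minus_commute[OF pH in_H(2), of n] by (intro bexI[of _ "s n"]) simp_all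
  qed
  have orth: "inner_prod H (h - p) k = 0" if k: "k \<in> ?T" for k
  proof (rule LIMSEQ_unique)
    have kH: "k \<in> space_carrier H"
      using k T by blast
    show "(\<lambda>n. inner_prod H (h - s n) k) \<longlonglongrightarrow> inner_prod H (h - p) k"
      using tendsto_diff[OF tendsto_const tendsto_inner_left[OF _ pH kH lim], of "inner_prod H h k"]
        in_H kH pH by (simp add: inner_diff_left)
    show "(\<lambda>n. inner_prod H (h - s n) k) \<longlonglongrightarrow> 0"
      by (rule Lim_null_comparison[OF always_eventually
            tendsto_mult_left_zero[OF LIMSEQ_inverse_real_of_nat]]) (use almost[OF k] in blast)
  qed
  have "inner_prod H p (h - p) = 0"
  proof (rule LIMSEQ_unique)
    show "(\<lambda>n. inner_prod H (s n) (h - p)) \<longlonglongrightarrow> inner_prod H p (h - p)"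
      by (rule tendsto_inner_left[OF _ pH _ lim]) (use in_H pH in auto)
    show "(\<lambda>n. inner_prod H (s n) (h - p)) \<longlonglongrightarrow> 0"
      using orth[OF sT] inner_commute[of "h - p" "s n" for n] in_H pH by simp
  qed
  then have cross: "inner_prod H p (h - p) = 0" "inner_prod H (h - p) p = 0"
    using inner_commute[of p "h - p"] in_H pH by auto
  have "inner_prod H (p + q) (p + q) = inner_prod H p p + inner_prod H q q"
    if "q \<in> space_carrier H" "inner_prod H p q = 0" "inner_prod H q p = 0" for q
    using that pH by (simp add: inner_add_left inner_add_right)
  from this[of "h - p"] have "inner_prod H h h = inner_prod H p p + inner_prod H (h - p) (h - p)"
    using cross in_H pH by simp
  then have "of_real ((space_norm H h)\<^sup>2) =
      complex_of_real ((space_norm H p)\<^sup>2 + (space_norm H (h - p))\<^sup>2)"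
    using in_H pH by (simp add: inner_self)
  then have "(space_norm H h)\<^sup>2 = (space_norm H p)\<^sup>2 + (space_norm H (h - p))\<^sup>2"
    using of_real_eq_iff by blast
  then have "(space_norm H p)\<^sup>2 \<le> (space_norm H h)\<^sup>2"
    "(space_norm H (h - p))\<^sup>2 \<le> (space_norm H h)\<^sup>2"
    by simp_all
  then have "space_norm H p \<le> space_norm H h" "space_norm H (h - p) \<le> space_norm H h"
    using norm_ge_0[OF h] by (blast intro: power2_le_imp_le)+
  with p orth show thesis by (rule that)
qed

end

section \<open>Square-summable families\<close>

definition ell2 :: "'i fun_space" where
  "ell2 = \<lparr> space_carrier = {c. (\<lambda>i. (cmod (c i))\<^sup>2) summable_on UNIV},
            inner_prod = (\<lambda>c d. \<Sum>\<^sub>\<infinity>i. c i * cnj (d i)) \<rparr>"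

lemma ell2_iff: "c \<in> space_carrier ell2 \<longleftrightarrow> (\<lambda>i. (cmod (c i))\<^sup>2) summable_on UNIV"
  by (simp add: ell2_def)

lemma ell2_inner: "inner_prod ell2 c d = (\<Sum>\<^sub>\<infinity>i. c i * cnj (d i))"
  by (simp add: ell2_def)

lemma ell2_bounded:
  assumes "\<And>F. finite F \<Longrightarrow> (\<Sum>i\<in>F. (cmod (c i))\<^sup>2) \<le> B"
  shows "c \<in> space_carrier ell2" "(\<Sum>\<^sub>\<infinity>i. (cmod (c i))\<^sup>2) \<le> B"
proof -
  show c: "c \<in> space_carrier ell2"
    unfolding ell2_iff
    by (rule nonneg_bdd_above_summable_on) (use assms in \<open>auto intro!: bdd_aboveI2[where M = B]\<close>)
  show "(\<Sum>\<^sub>\<infinity>i. (cmod (c i))\<^sup>2) \<le> B"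
    by (rule infsum_le_finite_sums) (use assms c in \<open>auto simp: ell2_iff\<close>)
qed

lemma ell2_product_summable:
  assumes "c \<in> space_carrier ell2" "d \<in> space_carrier ell2"
  shows "(\<lambda>i. cmod (c i * cnj (d i))) summable_on UNIV"
proof (rule summable_on_comparison_test)
  show "(\<lambda>i. (cmod (c i))\<^sup>2 + (cmod (d i))\<^sup>2) summable_on UNIV"
    using assms by (intro summable_on_add) (auto simp: ell2_iff)
  show "cmod (c i * cnj (d i)) \<le> (cmod (c i))\<^sup>2 + (cmod (d i))\<^sup>2" for i
    using sum_squares_bound[of "cmod (c i)" "cmod (d i)"]
      mult_nonneg_nonneg[OF norm_ge_zero[of "c i"] norm_ge_zero[of "d i"]]
    unfolding norm_mult complex_mod_cnj by linarith
qed auto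

lemma ell2_inner_summable:
  "c \<in> space_carrier ell2 \<Longrightarrow> d \<in> space_carrier ell2 \<Longrightarrow> (\<lambda>i. c i * cnj (d i)) summable_on UNIV"
  by (rule abs_summable_summable[OF ell2_product_summable])

lemma ell2_inner_self:
  "inner_prod ell2 c c = of_real (\<Sum>\<^sub>\<infinity>i. (cmod (c i))\<^sup>2)"
proof -
  have "inner_prod ell2 c c = (\<Sum>\<^sub>\<infinity>i. of_real ((cmod (c i))\<^sup>2))"
    unfolding ell2_inner by (rule infsum_cong) (simp add: complex_norm_square del: of_real_power)
  also have "\<dots> = of_real (\<Sum>\<^sub>\<infinity>i. (cmod (c i))\<^sup>2)"
  proof (rule infsum_bounded_linear_strong[OF _ bounded_linear_of_real])
    show "(\<lambda>i. complex_of_real ((cmod (c i))\<^sup>2)) summable_on UNIV \<longleftrightarrow>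
        (\<lambda>i. (cmod (c i))\<^sup>2) summable_on UNIV"
      using summable_on_of_real[of "\<lambda>i. (cmod (c i))\<^sup>2" UNIV]
        summable_on_Re[of "\<lambda>i. complex_of_real ((cmod (c i))\<^sup>2)" UNIV]
      by (auto simp del: of_real_power)
  qed
  finally show ?thesis .
qed

lemma ell2_norm_square: "(space_norm ell2 c)\<^sup>2 = (\<Sum>\<^sub>\<infinity>i. (cmod (c i))\<^sup>2)"
  by (simp add: space_norm_def ell2_inner_self infsum_nonneg)

lemma ell2_norm_nonneg: "0 \<le> space_norm ell2 c"
  by (simp add: space_norm_def ell2_inner_self infsum_nonneg)

lemma ell2_sum_le_norm:
  assumes "c \<in> space_carrier ell2" "finite F"
  shows "(\<Sum>i\<in>F. (cmod (c i))\<^sup>2) \<le> (space_norm ell2 c)\<^sup>2"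
  unfolding ell2_norm_square
  by (rule finite_sum_le_infsum) (use assms in \<open>auto simp: ell2_iff\<close>)

lemma ell2_norm_boundedI:
  assumes "\<And>F. finite F \<Longrightarrow> (\<Sum>i\<in>F. (cmod (c i))\<^sup>2) \<le> B\<^sup>2" "0 \<le> B"
  shows "c \<in> space_carrier ell2" "space_norm ell2 c \<le> B"
  using ell2_bounded(1)[of c "B\<^sup>2", OF assms(1)] ell2_bounded(2)[of c "B\<^sup>2", OF assms(1)]
    power2_le_imp_le[OF _ assms(2)] by (simp_all add: ell2_norm_square)

lemma subspace_ell2: "cfun.subspace (space_carrier ell2)"
  unfolding cfun.subspace_def
proof (intro conjI ballI allI)
  fix c d :: "'a \<Rightarrow> complex" and a :: complex
  assume c: "c \<in> space_carrier ell2"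
  have "(\<lambda>i. (cmod a)\<^sup>2 * (cmod (c i))\<^sup>2) summable_on UNIV"
    using c by (intro summable_on_cmult_right) (simp add: ell2_iff)
  then show "(\<lambda>x. a * c x) \<in> space_carrier ell2"
    by (simp add: ell2_iff norm_mult power_mult_distrib)
  assume d: "d \<in> space_carrier ell2"
  show "c + d \<in> space_carrier ell2"
    unfolding ell2_iff
  proof (rule summable_on_comparison_test)
    show "(\<lambda>i. 2 * (cmod (c i))\<^sup>2 + 2 * (cmod (d i))\<^sup>2) summable_on UNIV"
      using c d by (intro summable_on_add summable_on_cmult_right) (auto simp: ell2_iff)
    show "(cmod ((c + d) i))\<^sup>2 \<le> 2 * (cmod (c i))\<^sup>2 + 2 * (cmod (d i))\<^sup>2" for i
    proof -
      have "(cmod ((c + d) i))\<^sup>2 \<le> (cmod (c i) + cmod (d i))\<^sup>2"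
        by (intro power_mono) (auto intro: norm_triangle_ineq)
      also have "\<dots> \<le> 2 * (cmod (c i))\<^sup>2 + 2 * (cmod (d i))\<^sup>2"
        using sum_squares_bound[of "cmod (c i)" "cmod (d i)"] by (simp add: power2_sum)
      finally show ?thesis .
    qed
  qed auto
qed (simp add: ell2_iff)

lemma ell2_complete:
  assumes s: "\<And>n. s n \<in> space_carrier ell2"
    and Cauchy: "\<And>e. e > 0 \<Longrightarrow> \<exists>N. \<forall>m\<ge>N. \<forall>n\<ge>N. space_norm ell2 (s m - s n) < e"
  shows "\<exists>c\<in>space_carrier ell2. (\<lambda>n::nat. space_norm ell2 (s n - c)) \<longlonglongrightarrow> 0"
proof -
  have diff: "c - d \<in> space_carrier ell2" if "c \<in> space_carrier ell2" "d \<in> space_carrier ell2"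
    for c d :: "'a \<Rightarrow> complex"
    using cfun.subspace_diff[OF subspace_ell2 that] .
  have "Cauchy (\<lambda>n. s n i)" for i
  proof (rule metric_CauchyI)
    fix e :: real assume "e > 0"
    then obtain N where N: "\<forall>m\<ge>N. \<forall>n\<ge>N. space_norm ell2 (s m - s n) < e"
      using Cauchy by blast
    have "dist (s m i) (s n i) < e" if "m \<ge> N" "n \<ge> N" for m n
    proof -
      have "(cmod ((s m - s n) i))\<^sup>2 \<le> (space_norm ell2 (s m - s n))\<^sup>2"
        using ell2_sum_le_norm[OF diff[OF s s], of "{i}"] by simp
      then have "cmod ((s m - s n) i) \<le> space_norm ell2 (s m - s n)"
        by (rule power2_le_imp_le) (rule ell2_norm_nonneg)
      then show ?thesis
        using N that by (fastforce simp: dist_norm)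
    qed
    then show "\<exists>M. \<forall>m\<ge>M. \<forall>n\<ge>M. dist (s m i) (s n i) < e"
      by blast
  qed
  then obtain c where c: "\<And>i. (\<lambda>n. s n i) \<longlonglongrightarrow> c i"
    unfolding Cauchy_convergent_iff convergent_def by metis
  have close: "\<exists>N. \<forall>n\<ge>N. s n - c \<in> space_carrier ell2 \<and> space_norm ell2 (s n - c) \<le> e"
    if "e > 0" for e
  proof -
    obtain N where N: "\<forall>m\<ge>N. \<forall>n\<ge>N. space_norm ell2 (s m - s n) < e"
      using Cauchy \<open>e > 0\<close> by blast
    have "(\<Sum>i\<in>F. (cmod ((s n - c) i))\<^sup>2) \<le> e\<^sup>2" if "n \<ge> N" "finite F" for n F
    proof (rule tendsto_upperbound)
      show "(\<lambda>m. \<Sum>i\<in>F. (cmod ((s n - s m) i))\<^sup>2) \<longlonglongrightarrow> (\<Sum>i\<in>F. (cmod ((s n - c) i))\<^sup>2)"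
        by (auto intro!: tendsto_intros c)
      have "(\<Sum>i\<in>F. (cmod ((s n - s m) i))\<^sup>2) \<le> e\<^sup>2" if "m \<ge> N" for m
        using ell2_sum_le_norm[OF diff[OF s s] \<open>finite F\<close>, of n m] N \<open>n \<ge> N\<close> that
          power_mono[of "space_norm ell2 (s n - s m)" e 2] ell2_norm_nonneg
        by (meson less_imp_le order_trans)
      then show "\<forall>\<^sub>F m in sequentially. (\<Sum>i\<in>F. (cmod ((s n - s m) i))\<^sup>2) \<le> e\<^sup>2"
        by (auto simp: eventually_sequentially)
    qed simp
    then have "s n - c \<in> space_carrier ell2 \<and> space_norm ell2 (s n - c) \<le> e" if "n \<ge> N" for n
      using ell2_norm_boundedI[of "s n - c" e] \<open>e > 0\<close> that by (intro conjI) simp_all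
    then show ?thesis
      by blast
  qed
  obtain n where "s n - c \<in> space_carrier ell2"
    using close[of 1] by auto
  then have "c \<in> space_carrier ell2"
    using diff[OF s[of n], of "s n - c"] by simp
  moreover have "(\<lambda>n. space_norm ell2 (s n - c)) \<longlonglongrightarrow> 0"
  proof (rule LIMSEQ_I)
    fix e :: real assume "e > 0"
    then obtain N where "\<forall>n\<ge>N. space_norm ell2 (s n - c) \<le> e / 2"
      using close[of "e / 2"] by auto
    then have "\<forall>n\<ge>N. norm (space_norm ell2 (s n - c) - 0) < e"
      using \<open>e > 0\<close> ell2_norm_nonneg[of "s _ - c"] by (force simp: abs_of_nonneg)
    then show "\<exists>N. \<forall>n\<ge>N. norm (space_norm ell2 (s n - c) - 0) < e"
      by blast
  qed
  ultimately show ?thesis by blast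
qed

lemma hilbert_ell2: "hilbert_space_on UNIV (ell2 :: 'i fun_space)"
  unfolding hilbert_space_on_def
proof (intro conjI ballI allI impI)
  fix h k l :: "'i \<Rightarrow> complex" and a :: complex
  assume h: "h \<in> space_carrier ell2" and k: "k \<in> space_carrier ell2" and l: "l \<in> space_carrier ell2"
  have "(\<Sum>\<^sub>\<infinity>i. h i * cnj (l i) + k i * cnj (l i)) = inner_prod ell2 h l + inner_prod ell2 k l"
    unfolding ell2_inner by (intro infsum_add ell2_inner_summable h k l)
  then show "inner_prod ell2 (h + k) l = inner_prod ell2 h l + inner_prod ell2 k l"
    by (simp add: ell2_inner distrib_right)
  have "(\<Sum>\<^sub>\<infinity>i. a * (h i * cnj (l i))) = a * inner_prod ell2 h l"
    unfolding ell2_inner by (rule infsum_cmult_right')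
  then show "inner_prod ell2 (\<lambda>x. a * h x) l = a * inner_prod ell2 h l"
    by (simp add: ell2_inner mult.assoc)
  have "(\<Sum>\<^sub>\<infinity>i. cnj (h i * cnj (l i))) = cnj (inner_prod ell2 h l)"
    unfolding ell2_inner by (rule infsum_cnj)
  then show "inner_prod ell2 l h = cnj (inner_prod ell2 h l)"
    by (simp add: ell2_inner mult.commute)
next
  fix h :: "'i \<Rightarrow> complex"
  assume h: "h \<in> space_carrier ell2"
  show "0 \<le> Re (inner_prod ell2 h h)"
    by (simp add: ell2_inner_self infsum_nonneg)
  assume "inner_prod ell2 h h = 0"
  then have "(space_norm ell2 h)\<^sup>2 = 0"
    by (simp add: ell2_norm_square ell2_inner_self)
  then have "(cmod (h i))\<^sup>2 \<le> 0" for i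
    using ell2_sum_le_norm[OF h, of "{i}"] by simp
  then show "h = 0"
    by (auto simp: fun_eq_iff)
next
  fix s :: "nat \<Rightarrow> 'i \<Rightarrow> complex"
  assume "(\<forall>n. s n \<in> space_carrier ell2) \<and>
      (\<forall>e>0. \<exists>N. \<forall>m\<ge>N. \<forall>n\<ge>N. space_norm ell2 (s m - s n) < e)"
  then show "\<exists>h\<in>space_carrier ell2. (\<lambda>n. space_norm ell2 (s n - h)) \<longlonglongrightarrow> 0"
    by (intro ell2_complete) blast+
qed (auto simp: subspace_ell2)

interpretation ell2: hilbert_functions UNIV "ell2 :: 'i fun_space"
  by unfold_locales (rule hilbert_ell2)

section \<open>Reproducing kernel Hilbert spaces\<close>

lemma is_rkhs_hilbert: "is_rkhs X K H \<Longrightarrow> hilbert_functions X H"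
  by (simp add: is_rkhs_def hilbert_functions_def)

lemma is_rkhs_kernel:
  "is_rkhs X K H \<Longrightarrow> y \<in> X \<Longrightarrow> restrict0 X (K y) \<in> space_carrier H"
  by (simp add: is_rkhs_def)

lemma is_rkhs_reproducing:
  "is_rkhs X K H \<Longrightarrow> h \<in> space_carrier H \<Longrightarrow> y \<in> X \<Longrightarrow>
    inner_prod H h (restrict0 X (K y)) = h y"
  by (simp add: is_rkhs_def)

text \<open>The only function orthogonal to all kernel functions is zero, by the reproducing property.\<close>

lemma rkhs_kernels_dense:
  assumes rk: "is_rkhs X K H" and h: "h \<in> space_carrier H"
  shows "h \<in> closed_span H ((\<lambda>y. restrict0 X (K y)) ` X)"
proof -
  interpret hilbert_functions X H
    using is_rkhs_hilbert[OF rk] .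
  let ?S = "(\<lambda>y. restrict0 X (K y)) ` X"
  have S: "?S \<subseteq> space_carrier H"
    using is_rkhs_kernel[OF rk] by blast
  obtain p where p: "p \<in> closed_span H ?S"
    and orth: "\<And>k. k \<in> cfun.span ?S \<Longrightarrow> inner_prod H (h - p) k = 0"
    using orthogonal_projection[OF S h] by metis
  have hp: "h - p \<in> space_carrier H"
    using h p by (simp add: closed_span_def)
  have "(h - p) x = 0" for x
  proof (cases "x \<in> X")
    case True
    then have "restrict0 X (K x) \<in> cfun.span ?S"
      by (intro cfun.span_base) simp
    then show ?thesis
      using orth is_rkhs_reproducing[OF rk hp True] by metis
  qed (rule vanishes_outside[OF hp])
  then have "h = p"
    by (auto simp: fun_eq_iff)
  then show ?thesis
    using p by simp
qed

text \<open>
  On finite combinations of kernel functions the kernel determines the norm, and these combinations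
  are dense. A sequence of them that converges in one space is Cauchy, hence convergent, in the
  other; convergence in norm implies pointwise convergence, so the two limits are the same function.
\<close>

lemma rkhs_unique:
  assumes rk1: "is_rkhs X K H1" and rk2: "is_rkhs X K H2" and h: "h \<in> space_carrier H1"
  shows "h \<in> space_carrier H2" "space_norm H2 h = space_norm H1 h"
proof -
  interpret H1: hilbert_functions X H1
    using is_rkhs_hilbert[OF rk1] .
  interpret H2: hilbert_functions X H2
    using is_rkhs_hilbert[OF rk2] .
  let ?S = "(\<lambda>y. restrict0 X (K y)) ` X"
  have S: "?S \<subseteq> space_carrier H1" "?S \<subseteq> space_carrier H2"
    using is_rkhs_kernel[OF rk1] is_rkhs_kernel[OF rk2] by blast+
  note T = H1.span_in[OF S(1)] H2.span_in[OF S(2)]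
  have "t \<in> space_carrier H1 \<and> t \<in> space_carrier H2 \<and> inner_prod H1 s t = inner_prod H2 s t"
    if s: "s \<in> cfun.span ?S" and t: "t \<in> cfun.span ?S" for s t
    using t
  proof (induction rule: cfun.span_induct_alt)
    case base
    show ?case
      using subsetD[OF T(1) s] subsetD[OF T(2) s] H1.inner_diff_right[of s s s]
        H2.inner_diff_right[of s s s] H1.zero_in H2.zero_in by (simp add: zero_fun_def)
  next
    case (step c k t)
    then obtain y where y: "y \<in> X" "k = restrict0 X (K y)"
      by blast
    then have "inner_prod H1 s k = inner_prod H2 s k"
      using is_rkhs_reproducing[OF rk1 subsetD[OF T(1) s]]
        is_rkhs_reproducing[OF rk2 subsetD[OF T(2) s]] by simp
    moreover have "k \<in> space_carrier H1" "k \<in> space_carrier H2"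
      using y S by auto
    moreover have "(\<lambda>x. c * k x + t x) = (\<lambda>x. c * k x) + t"
      by (simp add: fun_eq_iff)
    ultimately show ?case
      using step.IH subsetD[OF T(1) s] subsetD[OF T(2) s]
      by (simp add: H1.inner_add_right H2.inner_add_right H1.inner_scale_right H2.inner_scale_right)
  qed
  then have norm: "space_norm H1 s = space_norm H2 s" if "s \<in> cfun.span ?S" for s
    using that by (simp add: space_norm_def)
  obtain s where s: "\<And>n. s n \<in> cfun.span ?S" "(\<lambda>n::nat. space_norm H1 (s n - h)) \<longlonglongrightarrow> 0"
    using H1.closed_span_sequence[OF S(1) rkhs_kernels_dense[OF rk1 h]] by blast
  have in1: "\<And>n. s n \<in> space_carrier H1" and in2: "\<And>n. s n \<in> space_carrier H2"
    using s(1) T by blast+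
  have "\<exists>N. \<forall>m\<ge>N. \<forall>n\<ge>N. space_norm H2 (s m - s n) < e" if "e > 0" for e
    using H1.convergent_imp_Cauchy[OF in1 h s(2) that] norm[OF cfun.span_diff[OF s(1) s(1)]]
    by simp
  then obtain k where k: "k \<in> space_carrier H2" "(\<lambda>n. space_norm H2 (s n - k)) \<longlonglongrightarrow> 0"
    using H2.complete[of s, OF in2] by blast
  have "h x = k x" for x
  proof (cases "x \<in> X")
    case True
    have "(\<lambda>n. s n x) \<longlonglongrightarrow> h x"
      using H1.tendsto_inner_left[OF in1 h is_rkhs_kernel[OF rk1 True] s(2)]
        is_rkhs_reproducing[OF rk1 in1 True] is_rkhs_reproducing[OF rk1 h True] by simp
    moreover have "(\<lambda>n. s n x) \<longlonglongrightarrow> k x"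
      using H2.tendsto_inner_left[OF in2 k(1) is_rkhs_kernel[OF rk2 True] k(2)]
        is_rkhs_reproducing[OF rk2 in2 True] is_rkhs_reproducing[OF rk2 k(1) True] by simp
    ultimately show ?thesis
      by (rule LIMSEQ_unique)
  qed (use H1.vanishes_outside[OF h] H2.vanishes_outside[OF k(1)] in simp)
  then have hk: "h = k"
    by (simp add: fun_eq_iff)
  then show "h \<in> space_carrier H2"
    using k(1) by simp
  have "(\<lambda>n. space_norm H2 (s n)) \<longlonglongrightarrow> space_norm H1 h"
    using H1.tendsto_norm[OF in1 h s(2)] norm[OF s(1)] by simp
  moreover have "(\<lambda>n. space_norm H2 (s n)) \<longlonglongrightarrow> space_norm H2 h"
    using H2.tendsto_norm[OF in2 k(1) k(2)] hk by simp
  ultimately show "space_norm H2 h = space_norm H1 h"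
    using LIMSEQ_unique by blast
qed

text \<open>
  A map \<open>\<Phi>\<close> into a sequence space turns each coefficient family \<open>c\<close> into the function
  \<open>x \<mapsto> \<langle>c, \<Phi> x\<rangle>\<close>. Different families can give the same function; the family
  orthogonal to all null families is the one of least norm, so these families carry the
  reproducing kernel Hilbert space of the kernel \<open>\<langle>\<Phi> y, \<Phi> x\<rangle>\<close>.
\<close>

locale feature_map =
  fixes X :: "'a set" and \<Phi> :: "'a \<Rightarrow> 'i \<Rightarrow> complex"
  assumes feature_in: "\<And>x. x \<in> X \<Longrightarrow> \<Phi> x \<in> space_carrier ell2"
begin

definition synth :: "('i \<Rightarrow> complex) \<Rightarrow> 'a \<Rightarrow> complex" where
  "synth c = restrict0 X (\<lambda>x. inner_prod ell2 c (\<Phi> x))"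

definition null_coeffs :: "('i \<Rightarrow> complex) set" where
  "null_coeffs = {c \<in> space_carrier ell2. synth c = 0}"

definition minimal_coeffs :: "('i \<Rightarrow> complex) set" where
  "minimal_coeffs = {c \<in> space_carrier ell2. \<forall>n\<in>null_coeffs. inner_prod ell2 c n = 0}"

definition feature_space :: "'a fun_space" where
  "feature_space =
     \<lparr> space_carrier = synth ` minimal_coeffs,
       inner_prod = (\<lambda>u v. inner_prod ell2 (inv_into minimal_coeffs synth u)
                                          (inv_into minimal_coeffs synth v)) \<rparr>"

lemma minimal_in: "c \<in> minimal_coeffs \<Longrightarrow> c \<in> space_carrier ell2"
  by (simp add: minimal_coeffs_def)

lemma null_in: "c \<in> null_coeffs \<Longrightarrow> c \<in> space_carrier ell2"
  by (simp add: null_coeffs_def)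

lemma synth_add:
  "c \<in> space_carrier ell2 \<Longrightarrow> d \<in> space_carrier ell2 \<Longrightarrow> synth (c + d) = synth c + synth d"
  by (auto simp: synth_def restrict0_def fun_eq_iff ell2.inner_add_left feature_in)

lemma synth_diff:
  "c \<in> space_carrier ell2 \<Longrightarrow> d \<in> space_carrier ell2 \<Longrightarrow> synth (c - d) = synth c - synth d"
  by (auto simp: synth_def restrict0_def fun_eq_iff ell2.inner_diff_left feature_in)

lemma synth_scale:
  "c \<in> space_carrier ell2 \<Longrightarrow> synth (\<lambda>i. a * c i) = (\<lambda>x. a * synth c x)"
  by (auto simp: synth_def restrict0_def fun_eq_iff ell2.inner_scale_left feature_in)

lemma subspace_null: "cfun.subspace null_coeffs"
  unfolding cfun.subspace_def
proof (intro conjI ballI allI)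
  show "0 \<in> null_coeffs"
    using synth_diff[of 0 0] by (simp add: null_coeffs_def)
qed (auto simp: null_coeffs_def synth_add synth_scale)

lemma subspace_minimal: "cfun.subspace minimal_coeffs"
  unfolding cfun.subspace_def
proof (intro conjI ballI allI)
  show "0 \<in> minimal_coeffs"
    using ell2.inner_diff_left[of "0 :: 'i \<Rightarrow> complex" 0] by (auto simp: minimal_coeffs_def null_in)
qed (auto simp: minimal_coeffs_def null_in ell2.inner_add_left ell2.inner_scale_left)

lemma feature_minimal: "x \<in> X \<Longrightarrow> \<Phi> x \<in> minimal_coeffs"
  unfolding minimal_coeffs_def
proof (intro CollectI conjI ballI feature_in)
  fix n assume x: "x \<in> X" and n: "n \<in> null_coeffs"
  have "inner_prod ell2 n (\<Phi> x) = synth n x"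
    using x by (simp add: synth_def restrict0_def)
  then have "inner_prod ell2 n (\<Phi> x) = 0"
    using n by (simp add: null_coeffs_def)
  then show "inner_prod ell2 (\<Phi> x) n = 0"
    using ell2.inner_commute[OF null_in[OF n] feature_in[OF x]] by simp
qed

lemma inj_on_synth: "inj_on synth minimal_coeffs"
proof (rule inj_onI)
  fix c d assume c: "c \<in> minimal_coeffs" and d: "d \<in> minimal_coeffs" and eq: "synth c = synth d"
  have "c - d \<in> null_coeffs"
    using c d eq by (simp add: null_coeffs_def minimal_in synth_diff)
  moreover have cd: "c - d \<in> minimal_coeffs"
    using cfun.subspace_diff[OF subspace_minimal c d] .
  ultimately have "inner_prod ell2 (c - d) (c - d) = 0"
    by (simp add: minimal_coeffs_def)
  then have "space_norm ell2 (c - d) = 0"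
    by (simp add: space_norm_def)
  then have "c - d = 0"
    using ell2.norm_eq_0 minimal_in[OF cd] by blast
  then show "c = d"
    by simp
qed

lemma feature_space_inner:
  "c \<in> minimal_coeffs \<Longrightarrow> d \<in> minimal_coeffs \<Longrightarrow>
    inner_prod feature_space (synth c) (synth d) = inner_prod ell2 c d"
  by (simp add: feature_space_def inv_into_f_f[OF inj_on_synth])

lemma feature_space_norm:
  "c \<in> minimal_coeffs \<Longrightarrow> space_norm feature_space (synth c) = space_norm ell2 c"
  by (simp add: space_norm_def feature_space_inner)

lemma feature_space_carrier: "space_carrier feature_space = synth ` minimal_coeffs"
  by (simp add: feature_space_def)

lemma minimal_closed:
  assumes "\<And>n. s n \<in> minimal_coeffs" "c \<in> space_carrier ell2"
    and "(\<lambda>n::nat. space_norm ell2 (s n - c)) \<longlonglongrightarrow> 0"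
  shows "c \<in> minimal_coeffs"
  unfolding minimal_coeffs_def
proof (intro CollectI conjI ballI assms(2))
  fix n assume n: "n \<in> null_coeffs"
  have "(\<lambda>k. inner_prod ell2 (s k) n) \<longlonglongrightarrow> inner_prod ell2 c n"
    using ell2.tendsto_inner_left[OF minimal_in[OF assms(1)] assms(2) null_in[OF n] assms(3)] .
  moreover have "inner_prod ell2 (s k) n = 0" for k
    using assms(1)[of k] n by (simp add: minimal_coeffs_def)
  ultimately show "inner_prod ell2 c n = 0"
    by (simp add: LIMSEQ_const_iff)
qed

lemma hilbert_feature_space: "hilbert_space_on X feature_space"
  unfolding hilbert_space_on_def feature_space_carrier
proof (intro conjI)
  show "\<forall>h\<in>synth ` minimal_coeffs. \<forall>x. x \<notin> X \<longrightarrow> h x = 0"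
    by (auto simp: synth_def restrict0_def)
  have zero: "synth 0 = 0"
    using synth_diff[of 0 0] by simp
  show "cfun.subspace (synth ` minimal_coeffs)"
    unfolding cfun.subspace_def
  proof (intro conjI ballI allI)
    show "0 \<in> synth ` minimal_coeffs"
      using zero cfun.subspace_0[OF subspace_minimal] by (metis imageI)
  next
    fix h k assume "h \<in> synth ` minimal_coeffs" "k \<in> synth ` minimal_coeffs"
    then show "h + k \<in> synth ` minimal_coeffs"
      using cfun.subspace_add[OF subspace_minimal] by (auto simp: synth_add[symmetric] minimal_in)
  next
    fix h a assume "h \<in> synth ` minimal_coeffs"
    then show "(\<lambda>x. a * h x) \<in> synth ` minimal_coeffs"
      using cfun.subspace_scale[OF subspace_minimal] by (auto simp: synth_scale[symmetric] minimal_in)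
  qed
  show "\<forall>h\<in>synth ` minimal_coeffs. \<forall>k\<in>synth ` minimal_coeffs. \<forall>l\<in>synth ` minimal_coeffs. \<forall>c.
      inner_prod feature_space (h + k) l = inner_prod feature_space h l + inner_prod feature_space k l \<and>
      inner_prod feature_space (\<lambda>x. c * h x) l = c * inner_prod feature_space h l \<and>
      inner_prod feature_space l h = cnj (inner_prod feature_space h l)"
  proof (intro ballI allI)
    fix h k l a
    assume "h \<in> synth ` minimal_coeffs" "k \<in> synth ` minimal_coeffs" "l \<in> synth ` minimal_coeffs"
    then obtain c d e where cde: "c \<in> minimal_coeffs" "d \<in> minimal_coeffs" "e \<in> minimal_coeffs"
      and eqs: "h = synth c" "k = synth d" "l = synth e"
      by blast
    have in_M: "c + d \<in> minimal_coeffs" "(\<lambda>i. a * c i) \<in> minimal_coeffs"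
      using cfun.subspace_add[OF subspace_minimal] cfun.subspace_scale[OF subspace_minimal] cde
      by blast+
    have 1: "inner_prod feature_space (h + k) l = inner_prod feature_space h l + inner_prod feature_space k l"
      unfolding eqs using cde in_M
      by (simp add: synth_add[symmetric] feature_space_inner minimal_in ell2.inner_add_left)
    have 2: "inner_prod feature_space (\<lambda>x. a * h x) l = a * inner_prod feature_space h l"
      unfolding eqs using cde in_M
      by (simp add: synth_scale[symmetric] feature_space_inner minimal_in ell2.inner_scale_left)
    have 3: "inner_prod feature_space l h = cnj (inner_prod feature_space h l)"
      unfolding eqs feature_space_inner[OF cde(3,1)] feature_space_inner[OF cde(1,3)]
      by (rule ell2.inner_commute) (use cde minimal_in in auto)
    from 1 2 3 show "inner_prod feature_space (h + k) l = inner_prod feature_space h l + inner_prod feature_space k l \<and>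
      inner_prod feature_space (\<lambda>x. a * h x) l = a * inner_prod feature_space h l \<and>
      inner_prod feature_space l h = cnj (inner_prod feature_space h l)"
      by (intro conjI)
  qed
  show "\<forall>h\<in>synth ` minimal_coeffs. 0 \<le> Re (inner_prod feature_space h h) \<and>
      (inner_prod feature_space h h = 0 \<longrightarrow> h = 0)"
  proof (intro ballI conjI impI)
    fix h assume "h \<in> synth ` minimal_coeffs"
    then obtain c where c: "c \<in> minimal_coeffs" "h = synth c"
      by blast
    have eq: "inner_prod feature_space h h = of_real ((space_norm ell2 c)\<^sup>2)"
      using c ell2.inner_self[OF minimal_in[OF c(1)]] by (simp add: feature_space_inner)
    then show "0 \<le> Re (inner_prod feature_space h h)"
      by simp
    assume "inner_prod feature_space h h = 0"
    then have "c = 0"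
      using eq ell2.norm_eq_0[OF minimal_in[OF c(1)]] by simp
    then show "h = 0"
      using c zero by simp
  qed
  show "\<forall>s. (\<forall>n. s n \<in> synth ` minimal_coeffs) \<and>
      (\<forall>e>0. \<exists>N. \<forall>m\<ge>N. \<forall>n\<ge>N. space_norm feature_space (s m - s n) < e) \<longrightarrow>
      (\<exists>h\<in>synth ` minimal_coeffs. (\<lambda>n::nat. space_norm feature_space (s n - h)) \<longlonglongrightarrow> 0)"
  proof (intro allI impI, elim conjE)
    fix s :: "nat \<Rightarrow> 'a \<Rightarrow> complex"
    assume "\<forall>n. s n \<in> synth ` minimal_coeffs"
      and Cauchy: "\<forall>e>0. \<exists>N. \<forall>m\<ge>N. \<forall>n\<ge>N. space_norm feature_space (s m - s n) < e"
    then obtain t where t: "\<And>n. t n \<in> minimal_coeffs" "\<And>n. s n = synth (t n)"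
      unfolding image_iff by metis
    have norm: "space_norm feature_space (synth c - synth d) = space_norm ell2 (c - d)"
      if "c \<in> minimal_coeffs" "d \<in> minimal_coeffs" for c d
      using that feature_space_norm[OF cfun.subspace_diff[OF subspace_minimal that]]
      by (simp add: synth_diff minimal_in)
    have "\<exists>N. \<forall>m\<ge>N. \<forall>n\<ge>N. space_norm ell2 (t m - t n) < e" if "e > 0" for e
      using Cauchy that unfolding t(2) norm[OF t(1) t(1)] by blast
    then obtain c where c: "c \<in> space_carrier ell2" "(\<lambda>n. space_norm ell2 (t n - c)) \<longlonglongrightarrow> 0"
      using ell2.complete[of t, OF minimal_in[OF t(1)]] by blast
    have cM: "c \<in> minimal_coeffs"
      using minimal_closed[OF t(1) c] .
    have "(\<lambda>n. space_norm feature_space (s n - synth c)) \<longlonglongrightarrow> 0"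
      unfolding t(2) norm[OF t(1) cM] by (rule c(2))
    then show "\<exists>h\<in>synth ` minimal_coeffs. (\<lambda>n. space_norm feature_space (s n - h)) \<longlonglongrightarrow> 0"
      using cM by blast
  qed
qed

lemma is_rkhs_feature_space: 
  assumes K: "\<And>x y. x \<in> X \<Longrightarrow> y \<in> X \<Longrightarrow> K y x = inner_prod ell2 (\<Phi> y) (\<Phi> x)"
  shows "is_rkhs X K feature_space"
  unfolding is_rkhs_def
proof (intro conjI ballI hilbert_feature_space)
  have kernel: "restrict0 X (K y) = synth (\<Phi> y)" if "y \<in> X" for y
    using K that by (auto simp: synth_def restrict0_def fun_eq_iff)
  show "restrict0 X (K y) \<in> space_carrier feature_space" if "y \<in> X" for y
    using kernel[OF that] feature_minimal[OF that] by (simp add: feature_space_carrier)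
  fix h y assume "h \<in> space_carrier feature_space" and y: "y \<in> X"
  then obtain c where c: "c \<in> minimal_coeffs" "h = synth c"
    by (auto simp: feature_space_carrier)
  show "inner_prod feature_space h (restrict0 X (K y)) = h y"
    unfolding kernel[OF y] c(2) feature_space_inner[OF c(1) feature_minimal[OF y]]
    using y by (simp add: synth_def restrict0_def)
qed

text \<open>
  Discarding the projection to the null families does not change the function and does not
  increase the norm. The null families are closed because evaluation at a point is continuous.
\<close>

lemma synth_contraction:
  assumes c: "c \<in> space_carrier ell2"
  shows "synth c \<in> space_carrier feature_space" "space_norm feature_space (synth c) \<le> space_norm ell2 c"
proof -
  have N: "null_coeffs \<subseteq> space_carrier ell2"
    using null_in by blast
  have span: "cfun.span null_coeffs = null_coeffs"
    using cfun.span_eq_iff subspace_null by blast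
  obtain p where p: "p \<in> closed_span ell2 null_coeffs"
    and orth: "\<And>k. k \<in> null_coeffs \<Longrightarrow> inner_prod ell2 (c - p) k = 0"
    and le: "space_norm ell2 (c - p) \<le> space_norm ell2 c"
    using ell2.orthogonal_projection[OF N c] unfolding span by metis
  obtain s where s: "\<And>n. s n \<in> null_coeffs" "(\<lambda>n. space_norm ell2 (s n - p)) \<longlonglongrightarrow> 0"
    using ell2.closed_span_sequence[OF N p] unfolding span by blast
  have pin: "p \<in> space_carrier ell2"
    using p by (simp add: closed_span_def)
  have "synth p x = 0" for x
  proof (cases "x \<in> X")
    case True
    have "(\<lambda>n. inner_prod ell2 (s n) (\<Phi> x)) \<longlonglongrightarrow> inner_prod ell2 p (\<Phi> x)"
      using ell2.tendsto_inner_left[OF null_in[OF s(1)] pin feature_in[OF True] s(2)] .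
    moreover have "inner_prod ell2 (s n) (\<Phi> x) = 0" for n
    proof -
      have "inner_prod ell2 (s n) (\<Phi> x) = synth (s n) x"
        using True by (simp add: synth_def restrict0_def)
      then show ?thesis
        using s(1)[of n] by (simp add: null_coeffs_def)
    qed
    ultimately show ?thesis
      using True by (simp add: LIMSEQ_const_iff synth_def restrict0_def)
  qed (simp add: synth_def restrict0_def)
  then have "synth p = 0"
    by (simp add: fun_eq_iff)
  then have eq: "synth (c - p) = synth c"
    using synth_diff[OF c pin] by simp
  have M: "c - p \<in> minimal_coeffs"
    using orth c pin by (simp add: minimal_coeffs_def)
  show "synth c \<in> space_carrier feature_space"
    using M eq by (metis feature_space_carrier imageI)
  show "space_norm feature_space (synth c) \<le> space_norm ell2 c"
    using feature_space_norm[OF M] eq le by simp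
qed

lemma minimal_preimage:
  assumes "h \<in> space_carrier feature_space"
  obtains c where "c \<in> space_carrier ell2" "synth c = h" "space_norm ell2 c = space_norm feature_space h"
proof -
  obtain c where c: "c \<in> minimal_coeffs" "h = synth c"
    using assms by (auto simp: feature_space_carrier)
  show thesis
    using that[OF minimal_in[OF c(1)]] c(2) feature_space_norm[OF c(1)] by simp
qed

end

section \<open>The Drury-Arveson space as a quotient of the full Fock space\<close>

definition short_words :: "nat \<Rightarrow> 'n::finite list set" where
  "short_words N = {\<alpha>. length \<alpha> < N}"

lemma finite_short_words: "finite (short_words N :: 'n::finite list set)"
  using finite_lists_length_le[OF finite[of "UNIV :: 'n set"], of N]
  by (rule finite_subset[rotated]) (auto simp: short_words_def)

lemma sum_short_words_Suc:
  fixes F :: "'n::finite list \<Rightarrow> 'b::comm_monoid_add"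
  shows "sum F (short_words (Suc N)) = F [] + (\<Sum>j\<in>UNIV. \<Sum>\<alpha>\<in>short_words N. F (j # \<alpha>))"
proof -
  let ?C = "\<lambda>(j :: 'n, \<alpha>). j # \<alpha>"
  have words: "short_words (Suc N) = insert [] (?C ` (UNIV \<times> short_words N))"
  proof (intro equalityI subsetI)
    fix \<alpha> :: "'n list" assume "\<alpha> \<in> short_words (Suc N)"
    then show "\<alpha> \<in> insert [] (?C ` (UNIV \<times> short_words N))"
      by (cases \<alpha>) (auto simp: short_words_def)
  qed (auto simp: short_words_def)
  have inj: "inj_on ?C (UNIV \<times> short_words N)"
    by (auto simp: inj_on_def)
  have "sum F (short_words (Suc N)) = F [] + sum F (?C ` (UNIV \<times> short_words N))"
    unfolding words by (rule sum.insert) (auto simp: finite_short_words)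
  also have "sum F (?C ` (UNIV \<times> short_words N)) = (\<Sum>x\<in>UNIV \<times> short_words N. F (?C x))"
    by (rule sum.reindex[OF inj, unfolded o_def])
  also have "\<dots> = (\<Sum>j\<in>UNIV. \<Sum>\<alpha>\<in>short_words N. F (j # \<alpha>))"
    unfolding sum.cartesian_product by (simp add: case_prod_beta)
  finally show ?thesis .
qed

lemma sum_words_bounded:
  fixes F :: "'n::finite list \<Rightarrow> real"
  assumes "\<And>N. sum F (short_words N) \<le> B" "\<And>\<alpha>. 0 \<le> F \<alpha>" "finite A"
  shows "sum F A \<le> B"
proof -
  have "A \<subseteq> short_words (Suc (Max (length ` A)))"
    using assms(3) by (auto simp: short_words_def less_Suc_eq_le)
  then have "sum F A \<le> sum F (short_words (Suc (Max (length ` A))))"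
    by (rule sum_mono2[OF finite_short_words]) (use assms(2) in auto)
  then show ?thesis
    using assms(1) order_trans by blast
qed

lemma words_tail_summable:
  fixes F :: "'n::finite list \<Rightarrow> complex"
  assumes "F summable_on UNIV"
  shows "(\<lambda>\<alpha>. F (j # \<alpha>)) summable_on UNIV"
proof -
  have "F summable_on ((#) j ` UNIV)"
    by (rule summable_on_subset_banach[OF assms]) simp
  then show ?thesis
    by (subst (asm) summable_on_reindex) (auto simp: o_def)
qed

lemma infsum_words:
  fixes F :: "'n::finite list \<Rightarrow> complex"
  assumes "F summable_on UNIV"
  shows "infsum F UNIV = F [] + (\<Sum>j\<in>UNIV. \<Sum>\<^sub>\<infinity>\<alpha>. F (j # \<alpha>))"
proof -
  let ?C = "\<lambda>(j :: 'n, \<alpha>). j # \<alpha>"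
  have words: "(UNIV :: 'n list set) = {[]} \<union> ?C ` (UNIV \<times> UNIV)"
  proof (intro equalityI subsetI)
    fix \<alpha> :: "'n list"
    show "\<alpha> \<in> {[]} \<union> ?C ` (UNIV \<times> UNIV)"
      by (cases \<alpha>) auto
  qed auto
  have inj: "inj_on ?C (UNIV \<times> UNIV)"
    by (auto simp: inj_on_def)
  have sub: "F summable_on A" for A
    by (rule summable_on_subset_banach[OF assms]) simp
  have "infsum F UNIV = infsum F {[]} + infsum F (?C ` (UNIV \<times> UNIV))"
    by (subst words, rule infsum_Un_disjoint) (auto intro: sub)
  also have "infsum F (?C ` (UNIV \<times> UNIV)) = infsum (F \<circ> ?C) (UNIV \<times> UNIV)"
    by (rule infsum_reindex[OF inj])
  also have "\<dots> = (\<Sum>\<^sub>\<infinity>j. \<Sum>\<^sub>\<infinity>\<alpha>. (F \<circ> ?C) (j, \<alpha>))"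
    by (rule infsum_Sigma_banach[symmetric]) (use sub summable_on_reindex[OF inj] in blast)
  finally show ?thesis
    by simp
qed

text \<open>
  Summed over all words, the products of letter weights form the geometric series of the total
  weight. Splitting off the first letter of a word gives the equation
  \<open>S = 1 + (\<Sum>j\<in>UNIV. a j) * S\<close> for its value, and the corresponding recursion for the
  truncated sums gives convergence.
\<close>

lemma sum_short_words_geometric:
  fixes a :: "'n::finite \<Rightarrow> real"
  assumes "\<And>j. 0 \<le> a j" "(\<Sum>j\<in>UNIV. a j) < 1"
  shows "(\<Sum>\<alpha>\<in>short_words N. prod_list (map a \<alpha>)) \<le> 1 / (1 - (\<Sum>j\<in>UNIV. a j))"
proof (induction N)
  case 0
  show ?case
    using assms by (simp add: short_words_def)
next
  case (Suc N)
  let ?s = "\<Sum>j\<in>UNIV. a j"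
  have "(\<Sum>\<alpha>\<in>short_words (Suc N). prod_list (map a \<alpha>)) =
      1 + ?s * (\<Sum>\<alpha>\<in>short_words N. prod_list (map a \<alpha>))"
    by (simp add: sum_short_words_Suc sum_distrib_left[symmetric] sum_distrib_right)
  also have "\<dots> \<le> 1 + ?s * (1 / (1 - ?s))"
    using Suc by (intro add_left_mono mult_left_mono sum_nonneg assms(1)) auto
  also have "\<dots> = 1 / (1 - ?s)"
    using assms(2) by (simp add: field_simps)
  finally show ?case .
qed

lemma prod_list_norm: "cmod (prod_list (map a \<alpha>)) = prod_list (map (\<lambda>j. cmod (a j)) \<alpha>)"
  by (induction \<alpha>) (auto simp: norm_mult)

lemma prod_list_map_nonneg: "(\<And>j. 0 \<le> a j) \<Longrightarrow> 0 \<le> prod_list (map a \<alpha> :: real list)"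
  by (induction \<alpha>) auto

lemma summable_words_geometric:
  fixes a :: "'n::finite \<Rightarrow> complex"
  assumes "(\<Sum>j\<in>UNIV. cmod (a j)) < 1"
  shows "(\<lambda>\<alpha>. prod_list (map a \<alpha>)) summable_on UNIV"
proof (rule abs_summable_summable, unfold prod_list_norm, rule nonneg_bdd_above_summable_on)
  show "bdd_above (sum (\<lambda>\<alpha>. prod_list (map (\<lambda>j. cmod (a j)) \<alpha>)) ` {F. F \<subseteq> UNIV \<and> finite F})"
    by (rule bdd_aboveI2, rule sum_words_bounded, rule sum_short_words_geometric)
       (use assms in \<open>auto intro: prod_list_map_nonneg\<close>)
qed (auto intro: prod_list_map_nonneg)

lemma infsum_words_geometric:
  fixes a :: "'n::finite \<Rightarrow> complex"
  assumes a: "(\<Sum>j\<in>UNIV. cmod (a j)) < 1"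
  shows "(\<Sum>\<^sub>\<infinity>\<alpha>. prod_list (map a \<alpha>)) = 1 / (1 - (\<Sum>j\<in>UNIV. a j))"
proof -
  let ?S = "\<Sum>\<^sub>\<infinity>\<alpha>. prod_list (map a \<alpha>)"
  have "?S = 1 + (\<Sum>j\<in>UNIV. \<Sum>\<^sub>\<infinity>\<alpha>. a j * prod_list (map a \<alpha>))"
    using infsum_words[OF summable_words_geometric[OF a]] by simp
  also have "\<dots> = 1 + (\<Sum>j\<in>UNIV. a j) * ?S"
    by (simp add: infsum_cmult_right' sum_distrib_right)
  finally have "?S * (1 - (\<Sum>j\<in>UNIV. a j)) = 1"
    by (simp add: algebra_simps)
  moreover have "1 - (\<Sum>j\<in>UNIV. a j) \<noteq> 0"
  proof
    assume "1 - (\<Sum>j\<in>UNIV. a j) = 0"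
    then have "cmod (\<Sum>j\<in>UNIV. a j) = 1"
      by (metis eq_iff_diff_eq_0 norm_one)
    then show False
      using norm_sum[of a UNIV] a by simp
  qed
  ultimately show ?thesis
    by (simp add: field_simps)
qed

definition word_monomial :: "complex ^ 'n \<Rightarrow> 'n list \<Rightarrow> complex" where
  "word_monomial z \<alpha> = prod_list (map (\<lambda>j. z $ j) \<alpha>)"

lemma word_monomial_simps [simp]:
  "word_monomial z [] = 1" "word_monomial z (j # \<alpha>) = z $ j * word_monomial z \<alpha>"
  by (simp_all add: word_monomial_def)

text \<open>
  The conjugate makes the function with coefficients \<open>c\<close> the power series
  \<open>\<Sum>\<^sub>\<infinity>\<alpha>. c \<alpha> * word_monomial z \<alpha>\<close>, which is linear in \<open>c\<close> and
  holomorphic in \<open>z\<close>.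
\<close>

definition fock_feature :: "complex ^ 'n \<Rightarrow> 'n list \<Rightarrow> complex" where
  "fock_feature z \<alpha> = cnj (word_monomial z \<alpha>)"

lemma word_monomial_mult:
  "word_monomial z \<alpha> * cnj (word_monomial w \<alpha>) = prod_list (map (\<lambda>j. z $ j * cnj (w $ j)) \<alpha>)"
  by (induction \<alpha>) (simp_all add: algebra_simps)

lemma norm_vec_square: "(norm z)\<^sup>2 = (\<Sum>j\<in>UNIV. (cmod (z $ j))\<^sup>2)" for z :: "complex ^ 'n"
  by (simp add: norm_vec_def L2_set_def sum_nonneg)

lemma sum_cmod_mult_le: "(\<Sum>j\<in>UNIV. cmod (z $ j * cnj (w $ j))) \<le> norm z * norm w"
  using L2_set_mult_ineq[of "\<lambda>j. cmod (z $ j)" "\<lambda>j. cmod (w $ j)" UNIV]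
  by (simp add: norm_vec_def norm_mult)

lemma cmod_cinner_le: "cmod (cinner x y) \<le> norm x * norm y"
  using norm_sum[of "\<lambda>j. x $ j * cnj (y $ j)" UNIV] sum_cmod_mult_le[of x y]
  unfolding cinner_def by linarith

lemma norm_mult_less_1:
  fixes z w :: "'a::real_normed_vector"
  assumes "z \<in> ball 0 1" "w \<in> ball 0 1"
  shows "norm z * norm w < 1"
  using assms mult_strict_mono'[of "norm z" 1 "norm w" 1] by simp

lemma fock_feature_in: "z \<in> ball 0 1 \<Longrightarrow> fock_feature z \<in> space_carrier ell2"
proof (rule ell2_bounded(1))
  fix F :: "'a list set"
  assume z: "z \<in> ball 0 1" and F: "finite F"
  have less: "(\<Sum>j\<in>UNIV. cmod (z $ j * cnj (z $ j))) < 1"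
    using sum_cmod_mult_le[of z z] norm_mult_less_1[OF z z] by linarith
  have "(cmod (fock_feature z \<alpha>))\<^sup>2 = prod_list (map (\<lambda>j. cmod (z $ j * cnj (z $ j))) \<alpha>)" for \<alpha>
    unfolding prod_list_norm[symmetric] word_monomial_mult[symmetric] fock_feature_def
    by (simp add: norm_mult power2_eq_square)
  then show "(\<Sum>\<alpha>\<in>F. (cmod (fock_feature z \<alpha>))\<^sup>2) \<le> 1 / (1 - (\<Sum>j\<in>UNIV. cmod (z $ j * cnj (z $ j))))"
    using sum_words_bounded[OF sum_short_words_geometric[OF _ less] _ F]
    by (simp add: prod_list_map_nonneg)
qed

lemma fock_feature_kernel:
  assumes "z \<in> ball 0 1" "w \<in> ball 0 1"
  shows "da_kernel w z = inner_prod ell2 (fock_feature w) (fock_feature z)"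
proof -
  have less: "(\<Sum>j\<in>UNIV. cmod (z $ j * cnj (w $ j))) < 1"
    using sum_cmod_mult_le[of z w] norm_mult_less_1[OF assms] by linarith
  have "inner_prod ell2 (fock_feature w) (fock_feature z) =
      (\<Sum>\<^sub>\<infinity>\<alpha>. prod_list (map (\<lambda>j. z $ j * cnj (w $ j)) \<alpha>))"
    unfolding ell2_inner fock_feature_def word_monomial_mult[symmetric] by (simp add: mult.commute)
  then show ?thesis
    unfolding infsum_words_geometric[OF less] by (simp add: da_kernel_def cinner_def)
qed

interpretation fock: feature_map "ball 0 1" "fock_feature :: complex ^ 'n \<Rightarrow> 'n list \<Rightarrow> complex"
  by unfold_locales (rule fock_feature_in)

lemma is_rkhs_fock:
  "is_rkhs (ball 0 1) da_kernel (fock.feature_space :: (complex ^ 'n) fun_space)"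
  by (rule fock.is_rkhs_feature_space) (rule fock_feature_kernel)

lemma is_rkhs_drury_arveson: "is_rkhs (ball 0 1) da_kernel drury_arveson"
  unfolding drury_arveson_def rkhs_def using is_rkhs_fock by (rule someI)

section \<open>Resolvents as contractive multipliers\<close>

text \<open>
  On coefficients over words, multiplication by \<open>\<langle>z, q\<rangle>\<close> prepends a letter \<open>j\<close> with the
  weight \<open>cnj (q $ j)\<close>. So \<open>(1 + s - \<langle>z, q\<rangle>) * k = s * h\<close> can be solved for the
  coefficients of \<open>k\<close> by recursion on words.
\<close>

primrec resolvent_coeffs ::
  "real \<Rightarrow> complex ^ 'n \<Rightarrow> ('n list \<Rightarrow> complex) \<Rightarrow> 'n list \<Rightarrow> complex" where
  "resolvent_coeffs s q c [] = (of_real s * c []) / of_real (1 + s)"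
| "resolvent_coeffs s q c (j # \<alpha>) =
     (of_real s * c (j # \<alpha>) + cnj (q $ j) * resolvent_coeffs s q c \<alpha>) / of_real (1 + s)"

lemma cmod_square_convex:
  assumes "0 < s"
  shows "(cmod ((of_real s * a + b) / of_real (1 + s)))\<^sup>2 \<le> (s * (cmod a)\<^sup>2 + (cmod b)\<^sup>2) / (1 + s)"
proof -
  let ?x = "cmod a" and ?y = "cmod b"
  have "cmod (of_real s * a + b) \<le> s * ?x + ?y"
    using norm_triangle_ineq[of "of_real s * a" b] assms by (simp add: norm_mult)
  then have "(cmod (of_real s * a + b))\<^sup>2 \<le> (s * ?x + ?y)\<^sup>2"
    by (intro power_mono) auto
  also have "\<dots> = (1 + s) * (s * ?x\<^sup>2 + ?y\<^sup>2) - s * (?x - ?y)\<^sup>2"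
    by (simp add: power2_eq_square algebra_simps)
  also have "\<dots> \<le> (1 + s) * (s * ?x\<^sup>2 + ?y\<^sup>2)"
    using assms by simp
  finally have "(cmod (of_real s * a + b))\<^sup>2 / (1 + s)\<^sup>2 \<le> (1 + s) * (s * ?x\<^sup>2 + ?y\<^sup>2) / (1 + s)\<^sup>2"
    by (intro divide_right_mono) auto
  moreover have "cmod (of_real (1 + s)) = 1 + s"
    using assms by (simp only: norm_of_real)
  ultimately show ?thesis
    using assms by (simp add: norm_divide power_divide power2_eq_square del: of_real_add)
qed

text \<open>
  Each coefficient is a convex combination, with weights \<open>s / (1 + s)\<close> and \<open>1 / (1 + s)\<close>, of
  a coefficient of \<open>c\<close> and of a coefficient of the result that is shifted by one letter \<open>j\<close>
  and weighted by \<open>cnj (q $ j)\<close>; this weighted shift does not increase the norm since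
  \<open>norm q \<le> 1\<close>. So the squared norm \<open>T\<close> of the
  result, cut off at word length \<open>N\<close>, satisfies
  \<open>(1 + s) * T (N + 1) \<le> s * (space_norm ell2 c)\<^sup>2 + T N\<close>, which keeps it below
  \<open>(space_norm ell2 c)\<^sup>2\<close>.
\<close>

lemma resolvent_coeffs_bound:
  assumes s: "0 < s" and q: "norm q \<le> 1" and c: "c \<in> space_carrier ell2"
  shows "resolvent_coeffs s q c \<in> space_carrier ell2"
    "space_norm ell2 (resolvent_coeffs s q c) \<le> space_norm ell2 c"
proof -
  let ?r = "resolvent_coeffs s q c" and ?B = "(space_norm ell2 c)\<^sup>2"
  have "(\<Sum>\<alpha>\<in>short_words N. (cmod (?r \<alpha>))\<^sup>2) \<le> ?B" for N
  proof (induction N)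
    case 0
    show ?case by (simp add: short_words_def)
  next
    case (Suc N)
    let ?T = "\<Sum>\<alpha>\<in>short_words N. (cmod (?r \<alpha>))\<^sup>2"
    have q2: "(\<Sum>j\<in>UNIV. (cmod (q $ j))\<^sup>2) \<le> 1"
      using q by (simp add: norm_vec_square[symmetric] power_le_one)
    have empty: "(cmod (?r []))\<^sup>2 \<le> (s * (cmod (c []))\<^sup>2) / (1 + s)"
      using cmod_square_convex[OF s, of "c []" 0] by simp
    have cons: "(cmod (?r (j # \<alpha>)))\<^sup>2 \<le>
        (s * (cmod (c (j # \<alpha>)))\<^sup>2 + (cmod (q $ j))\<^sup>2 * (cmod (?r \<alpha>))\<^sup>2) / (1 + s)" for j \<alpha>
      using cmod_square_convex[OF s, of "c (j # \<alpha>)" "cnj (q $ j) * ?r \<alpha>"]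
      by (simp add: norm_mult power_mult_distrib)
    have "(\<Sum>\<alpha>\<in>short_words (Suc N). (cmod (?r \<alpha>))\<^sup>2) \<le> (s * (cmod (c []))\<^sup>2) / (1 + s) +
        (\<Sum>j\<in>UNIV. \<Sum>\<alpha>\<in>short_words N.
          (s * (cmod (c (j # \<alpha>)))\<^sup>2 + (cmod (q $ j))\<^sup>2 * (cmod (?r \<alpha>))\<^sup>2) / (1 + s))"
      unfolding sum_short_words_Suc by (intro add_mono sum_mono empty cons)
    also have "\<dots> = (s * (\<Sum>\<alpha>\<in>short_words (Suc N). (cmod (c \<alpha>))\<^sup>2) +
        (\<Sum>j\<in>UNIV. (cmod (q $ j))\<^sup>2) * ?T) / (1 + s)"
      unfolding sum_short_words_Suc
      by (simp add: sum_divide_distrib[symmetric] add_divide_distrib[symmetric] sum.distrib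
          sum_distrib_left sum_distrib_right distrib_left) (rule disjI2, rule sum.swap)
    also have "\<dots> \<le> (s * ?B + 1 * ?B) / (1 + s)"
      using s Suc q2 ell2_sum_le_norm[OF c finite_short_words]
      by (intro divide_right_mono add_mono mult_left_mono mult_mono sum_nonneg) auto
    also have "\<dots> = ?B"
      using s by (simp add: field_simps)
    finally show ?case .
  qed
  then have "(\<Sum>\<alpha>\<in>F. (cmod (?r \<alpha>))\<^sup>2) \<le> ?B" if "finite F" for F
    by (rule sum_words_bounded) (use that in auto)
  then show "?r \<in> space_carrier ell2" "space_norm ell2 ?r \<le> space_norm ell2 c"
    by (auto intro!: ell2_norm_boundedI ell2_norm_nonneg)
qed

lemma resolvent_denominator_nonzero:
  assumes "0 < s" "norm q \<le> 1" "norm z \<le> 1"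
  shows "of_real (1 + s) - cinner z q \<noteq> 0"
proof
  assume "of_real (1 + s) - cinner z q = 0"
  then have "cinner z q = of_real (1 + s)"
    by (simp only: eq_iff_diff_eq_0[symmetric])
  then have "cmod (cinner z q) = 1 + s"
    using assms(1) by (simp only: norm_of_real)
  moreover have "cmod (cinner z q) \<le> norm z * norm q"
    by (rule cmod_cinner_le)
  moreover have "norm z * norm q \<le> 1"
    using assms by (simp add: mult_le_one)
  ultimately show False
    using assms(1) by linarith
qed

text \<open>
  Summed over all words, the recursion becomes \<open>(1 + s) * R = s * C + cinner z q * R\<close> for the
  values \<open>C\<close> and \<open>R\<close> at \<open>z\<close> of the two functions.
\<close>

lemma synth_resolvent:
  fixes q :: "complex ^ 'n"
  assumes s: "0 < s" and q: "norm q \<le> 1" and c: "c \<in> space_carrier ell2" and z: "z \<in> ball 0 1"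
  shows "fock.synth (resolvent_coeffs s q c) z = of_real s / (of_real (1 + s) - cinner z q) * fock.synth c z"
proof -
  let ?r = "resolvent_coeffs s q c" and ?m = "word_monomial z"
  have synth: "fock.synth d z = (\<Sum>\<^sub>\<infinity>\<alpha>. d \<alpha> * ?m \<alpha>)" for d
    using z by (simp add: fock.synth_def restrict0_def ell2_inner fock_feature_def)
  have summable: "(\<lambda>\<alpha>. d \<alpha> * ?m \<alpha>) summable_on UNIV" if "d \<in> space_carrier ell2" for d
    using ell2_inner_summable[OF that fock_feature_in[OF z]] by (simp add: fock_feature_def)
  note sum_c = summable[OF c] and sum_r = summable[OF resolvent_coeffs_bound(1)[OF s q c]]
  let ?C = "\<Sum>\<^sub>\<infinity>\<alpha>. c \<alpha> * ?m \<alpha>" and ?R = "\<Sum>\<^sub>\<infinity>\<alpha>. ?r \<alpha> * ?m \<alpha>"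
  have nz: "complex_of_real (1 + s) \<noteq> 0"
    using s by (simp only: of_real_eq_0_iff)
  have letter: "of_real (1 + s) * (\<Sum>\<^sub>\<infinity>\<alpha>. ?r (j # \<alpha>) * ?m (j # \<alpha>)) =
      of_real s * (\<Sum>\<^sub>\<infinity>\<alpha>. c (j # \<alpha>) * ?m (j # \<alpha>)) + z $ j * cnj (q $ j) * ?R" for j
  proof -
    have step: "of_real (1 + s) * ?r (j # \<alpha>) = of_real s * c (j # \<alpha>) + cnj (q $ j) * ?r \<alpha>" for \<alpha>
      using nz by (simp del: of_real_add)
    have "of_real (1 + s) * (\<Sum>\<^sub>\<infinity>\<alpha>. ?r (j # \<alpha>) * ?m (j # \<alpha>)) =
        (\<Sum>\<^sub>\<infinity>\<alpha>. of_real (1 + s) * (?r (j # \<alpha>) * ?m (j # \<alpha>)))"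
      by (rule infsum_cmult_right'[symmetric])
    also have "\<dots> = (\<Sum>\<^sub>\<infinity>\<alpha>. of_real s * (c (j # \<alpha>) * ?m (j # \<alpha>)) + z $ j * cnj (q $ j) * (?r \<alpha> * ?m \<alpha>))"
      by (rule infsum_cong, simp only: mult.assoc[symmetric] step) (simp add: algebra_simps)
    also have "\<dots> = (\<Sum>\<^sub>\<infinity>\<alpha>. of_real s * (c (j # \<alpha>) * ?m (j # \<alpha>))) + (\<Sum>\<^sub>\<infinity>\<alpha>. z $ j * cnj (q $ j) * (?r \<alpha> * ?m \<alpha>))"
      by (intro infsum_add summable_on_cmult_right words_tail_summable[OF sum_c] sum_r)
    finally show ?thesis
      by (simp only: infsum_cmult_right')
  qed
  have "of_real (1 + s) * ?R = of_real s * c [] +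
      (\<Sum>j\<in>UNIV. of_real (1 + s) * (\<Sum>\<^sub>\<infinity>\<alpha>. ?r (j # \<alpha>) * ?m (j # \<alpha>)))"
    unfolding infsum_words[OF sum_r] using nz by (simp add: distrib_left sum_distrib_left del: of_real_add)
  also have "\<dots> = of_real s * (c [] * ?m [] + (\<Sum>j\<in>UNIV. \<Sum>\<^sub>\<infinity>\<alpha>. c (j # \<alpha>) * ?m (j # \<alpha>))) + cinner z q * ?R"
    unfolding letter cinner_def by (simp add: sum.distrib distrib_left sum_distrib_left sum_distrib_right del: word_monomial_simps(2))
  also have "\<dots> = of_real s * ?C + cinner z q * ?R"
    unfolding infsum_words[OF sum_c] ..
  finally have "(of_real (1 + s) - cinner z q) * ?R = of_real s * ?C"
    by (simp add: left_diff_distrib)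
  moreover have "of_real (1 + s) - cinner z q \<noteq> 0"
    using resolvent_denominator_nonzero[OF s q] z by simp
  ultimately show ?thesis
    unfolding synth by (simp add: field_simps del: of_real_add)
qed

definition resolvent_multiplier :: "real \<Rightarrow> complex ^ 'n \<Rightarrow> complex ^ 'n \<Rightarrow> complex" where
  "resolvent_multiplier s q = restrict0 (ball 0 1) (\<lambda>z. of_real s / (of_real (1 + s) - cinner z q))"

lemma resolvent_multiplier_contraction:
  fixes q :: "complex ^ 'n"
  assumes s: "0 < s" and q: "norm q \<le> 1" and h: "h \<in> space_carrier drury_arveson"
  shows "resolvent_multiplier s q * h \<in> space_carrier drury_arveson"
    "space_norm drury_arveson (resolvent_multiplier s q * h) \<le> space_norm drury_arveson h"
proof -
  note h_fock = rkhs_unique[OF is_rkhs_drury_arveson is_rkhs_fock h]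
  obtain c where c: "c \<in> space_carrier ell2" "fock.synth c = h"
    "space_norm ell2 c = space_norm fock.feature_space h"
    using fock.minimal_preimage[OF h_fock(1)] .
  have "resolvent_multiplier s q * h = fock.synth (resolvent_coeffs s q c)"
  proof
    fix z
    show "(resolvent_multiplier s q * h) z = fock.synth (resolvent_coeffs s q c) z"
    proof (cases "z \<in> ball 0 1")
      case True
      then show ?thesis
        using synth_resolvent[OF s q c(1) True] c(2) by (simp add: resolvent_multiplier_def restrict0_def)
    next
      case False
      then show ?thesis
        by (simp add: resolvent_multiplier_def restrict0_def fock.synth_def)
    qed
  qed
  then have eq: "fock.synth (resolvent_coeffs s q c) = resolvent_multiplier s q * h" ..
  note r = resolvent_coeffs_bound[OF s q c(1)]
  note in_fock = fock.synth_contraction[OF r(1), unfolded eq]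
  note in_da = rkhs_unique[OF is_rkhs_fock is_rkhs_drury_arveson in_fock(1)]
  show "resolvent_multiplier s q * h \<in> space_carrier drury_arveson"
    by (rule in_da(1))
  show "space_norm drury_arveson (resolvent_multiplier s q * h) \<le> space_norm drury_arveson h"
    using in_da(2) in_fock(2) r(2) c(3) h_fock(2) by linarith
qed

section \<open>Multipliers on a subset of the ball\<close>

interpretation da: hilbert_functions "ball 0 1" "drury_arveson :: (complex ^ 'n) fun_space"
  by (rule is_rkhs_hilbert[OF is_rkhs_drury_arveson])

abbreviation da_kernel_at :: "complex ^ 'n \<Rightarrow> complex ^ 'n \<Rightarrow> complex" where
  "da_kernel_at y \<equiv> restrict0 (ball 0 1) (da_kernel y)"

lemmas kernel_in_da = is_rkhs_kernel[OF is_rkhs_drury_arveson]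
lemmas da_reproducing = is_rkhs_reproducing[OF is_rkhs_drury_arveson]

lemma kernels_subset:
  "V \<subseteq> ball 0 1 \<Longrightarrow> da_kernel_at ` V \<subseteq> space_carrier drury_arveson"
  using kernel_in_da by blast

lemma kernel_span_in: "h \<in> kernel_span V \<Longrightarrow> h \<in> space_carrier drury_arveson"
  by (simp add: kernel_span_def closed_span_def)

lemma inner_kernel_span_zero:
  assumes V: "V \<subseteq> ball 0 1" and h: "h \<in> kernel_span V"
    and d: "d \<in> space_carrier drury_arveson" "\<And>x. x \<in> V \<Longrightarrow> d x = 0"
  shows "inner_prod drury_arveson h d = 0"
proof -
  let ?S = "da_kernel_at ` V"
  note S = kernels_subset[OF V]
  have "s \<in> space_carrier drury_arveson \<and> inner_prod drury_arveson d s = 0"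
    if "s \<in> cfun.span ?S" for s
    using that
  proof (induction rule: cfun.span_induct_alt)
    case base
    show ?case
      using da.inner_diff_right[OF d(1) d(1) d(1)] da.zero_in by (simp add: zero_fun_def)
  next
    case (step c k t)
    then obtain y where y: "y \<in> V" "k = da_kernel_at y"
      by blast
    then have "k \<in> space_carrier drury_arveson" "inner_prod drury_arveson d k = 0"
      using da_reproducing[OF d(1)] d(2) kernel_in_da subsetD[OF V y(1)] by auto
    moreover have "(\<lambda>x. c * k x + t x) = (\<lambda>x. c * k x) + t"
      by (simp add: fun_eq_iff)
    ultimately show ?case
      using step.IH d(1) by (simp add: da.inner_add_right da.inner_scale_right)
  qed
  then have orth: "inner_prod drury_arveson s d = 0" if "s \<in> cfun.span ?S" for s
    using da.inner_commute[OF d(1)] that by simp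
  obtain s where s: "\<And>n. s n \<in> cfun.span ?S" "(\<lambda>n. space_norm drury_arveson (s n - h)) \<longlonglongrightarrow> 0"
    using da.closed_span_sequence[OF S h[unfolded kernel_span_def]] by blast
  have "(\<lambda>n. inner_prod drury_arveson (s n) d) \<longlonglongrightarrow> inner_prod drury_arveson h d"
    using da.tendsto_inner_left[OF _ kernel_span_in[OF h] d(1) s(2)] da.span_in[OF S] s(1) by blast
  then show ?thesis
    using orth[OF s(1)] by (simp add: LIMSEQ_const_iff)
qed

text \<open>
  A difference of two elements of \<open>kernel_span V\<close> that vanishes on \<open>V\<close> is orthogonal to both
  of them, hence to itself. So the norm of \<open>variety_space V\<close> is that of the extension to the
  ball that lies in \<open>kernel_span V\<close>.
\<close>

lemma inj_on_restrict_kernel_span: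
  assumes V: "V \<subseteq> ball 0 1"
  shows "inj_on (restrict0 V) (kernel_span V)"
proof (rule inj_onI)
  fix h k assume h: "h \<in> kernel_span V" and k: "k \<in> kernel_span V"
    and eq: "restrict0 V h = restrict0 V k"
  note in_H = kernel_span_in[OF h] kernel_span_in[OF k]
  have zero: "(h - k) x = 0" if "x \<in> V" for x
    using fun_cong[OF eq, of x] that by (simp add: restrict0_def)
  have d: "h - k \<in> space_carrier drury_arveson"
    using in_H by simp
  have "inner_prod drury_arveson (h - k) (h - k) = 0"
    using da.inner_diff_left[OF in_H d] inner_kernel_span_zero[OF V h d zero]
      inner_kernel_span_zero[OF V k d zero] by simp
  then have "h - k = 0"
    using da.norm_eq_0[OF d] by (simp add: space_norm_def)
  then show "h = k"
    by simp
qed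

lemma variety_space_carrier: "space_carrier (variety_space V) = restrict0 V ` kernel_span V"
  by (simp add: variety_space_def)

lemma variety_space_norm:
  assumes "V \<subseteq> ball 0 1" "h \<in> kernel_span V"
  shows "space_norm (variety_space V) (restrict0 V h) = space_norm drury_arveson h"
  using inv_into_f_f[OF inj_on_restrict_kernel_span[OF assms(1)] assms(2)]
  by (simp add: space_norm_def variety_space_def)

lemma restrict0_mult: "restrict0 V \<psi> * restrict0 V h = restrict0 V (\<psi> * h)"
  by (simp add: restrict0_def fun_eq_iff)

text \<open>
  The part of \<open>h\<close> that the projection onto \<open>kernel_span V\<close> removes is orthogonal to the
  kernel functions at the points of \<open>V\<close>, so it vanishes on \<open>V\<close>.
\<close>

lemma compress_to_kernel_span:
  assumes V: "V \<subseteq> ball 0 1" and h: "h \<in> space_carrier drury_arveson"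
  obtains p where "p \<in> kernel_span V" "restrict0 V p = restrict0 V h"
    "space_norm drury_arveson p \<le> space_norm drury_arveson h"
proof -
  obtain p where p: "p \<in> kernel_span V"
    and orth: "\<And>k. k \<in> cfun.span (da_kernel_at ` V) \<Longrightarrow> inner_prod drury_arveson (h - p) k = 0"
    and le: "space_norm drury_arveson p \<le> space_norm drury_arveson h"
    using da.orthogonal_projection[OF kernels_subset[OF V] h] unfolding kernel_span_def by metis
  have d: "h - p \<in> space_carrier drury_arveson"
    using h kernel_span_in[OF p] by simp
  have "(h - p) x = 0" if "x \<in> V" for x
    using orth[of "da_kernel_at x"] da_reproducing[OF d subsetD[OF V that]] that
    by (metis cfun.span_base imageI)
  then have "restrict0 V p = restrict0 V h"
    by (auto simp: restrict0_def fun_eq_iff)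
  then show thesis
    using that p le by blast
qed

lemma mult_norm_restrict_le_1:
  assumes V: "V \<subseteq> ball 0 1"
    and \<psi>: "\<And>h. h \<in> space_carrier drury_arveson \<Longrightarrow> \<psi> * h \<in> space_carrier drury_arveson"
      "\<And>h. h \<in> space_carrier drury_arveson \<Longrightarrow>
        space_norm drury_arveson (\<psi> * h) \<le> space_norm drury_arveson h"
  shows "mult_norm (variety_space V) (restrict0 V \<psi>) \<le> 1"
  unfolding mult_norm_def
proof (rule SUP_least)
  fix u assume "u \<in> {h \<in> space_carrier (variety_space V). space_norm (variety_space V) h \<le> 1}"
  then obtain h where h: "h \<in> kernel_span V" "u = restrict0 V h" "space_norm (variety_space V) u \<le> 1"
    by (auto simp: variety_space_carrier)
  note hH = kernel_span_in[OF h(1)]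
  obtain p where p: "p \<in> kernel_span V" "restrict0 V p = restrict0 V (\<psi> * h)"
    "space_norm drury_arveson p \<le> space_norm drury_arveson (\<psi> * h)"
    using compress_to_kernel_span[OF V \<psi>(1)[OF hH]] .
  have "space_norm (variety_space V) (restrict0 V \<psi> * u) = space_norm drury_arveson p"
    unfolding h(2) restrict0_mult p(2)[symmetric] by (rule variety_space_norm[OF V p(1)])
  also have "\<dots> \<le> 1"
    using p(3) \<psi>(2)[OF hH] h(3)[unfolded h(2) variety_space_norm[OF V h(1)]] by linarith
  finally show "ennreal (space_norm (variety_space V) (restrict0 V \<psi> * u)) \<le> 1"
    by (simp add: ennreal_le_1)
qed

lemma variety_multiplier_apply:
  assumes V: "V \<subseteq> ball 0 1" and \<phi>: "\<phi> \<in> variety_multipliers V"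
    and C: "mult_norm (variety_space V) \<phi> \<le> ennreal C" "0 \<le> C"
    and h: "h \<in> kernel_span V" "space_norm drury_arveson h \<le> 1"
  obtains p where "p \<in> space_carrier drury_arveson" "space_norm drury_arveson p \<le> C"
    "\<And>x. x \<in> V \<Longrightarrow> p x = \<phi> x * h x"
proof -
  obtain \<psi> where \<psi>: "\<psi> \<in> da_multipliers" "\<phi> = restrict0 V \<psi>"
    using \<phi> by (auto simp: variety_multipliers_def)
  then have "\<psi> * h \<in> space_carrier drury_arveson"
    using kernel_span_in[OF h(1)] by (simp add: da_multipliers_def Mult_def)
  then obtain p where p: "p \<in> kernel_span V" "restrict0 V p = restrict0 V (\<psi> * h)"
    using compress_to_kernel_span[OF V] by metis
  have eq: "\<phi> * restrict0 V h = restrict0 V p"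
    unfolding \<psi>(2) restrict0_mult p(2) ..
  have "ennreal (space_norm (variety_space V) (\<phi> * restrict0 V h)) \<le> mult_norm (variety_space V) \<phi>"
    unfolding mult_norm_def
    by (rule SUP_upper) (use h variety_space_norm[OF V h(1)] in \<open>simp add: variety_space_carrier\<close>)
  then have "ennreal (space_norm drury_arveson p) \<le> ennreal C"
    using C(1) unfolding eq variety_space_norm[OF V p(1)] by (rule order_trans)
  then have "space_norm drury_arveson p \<le> C"
    using C(2) by (simp add: ennreal_le_iff)
  moreover have "p x = \<phi> x * h x" if "x \<in> V" for x
    using fun_cong[OF eq, of x] that by (simp add: restrict0_def)
  ultimately show thesis
    using that kernel_span_in[OF p(1)] by blast
qed

text \<open>
  This is the squared cosine of the angle between the kernel functions at \<open>x\<close> and \<open>y\<close>;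
  one minus it is the square of the pseudohyperbolic distance of the ball.
\<close>

definition kernel_cos2 :: "complex ^ 'n \<Rightarrow> complex ^ 'n \<Rightarrow> real" where
  "kernel_cos2 x y = (1 - (norm x)\<^sup>2) * (1 - (norm y)\<^sup>2) / (cmod (1 - cinner x y))\<^sup>2"

lemma cinner_self: "cinner x x = of_real ((norm x)\<^sup>2)"
  by (simp add: cinner_def norm_vec_square complex_norm_square del: of_real_power)

lemma cinner_commute: "cinner y x = cnj (cinner x y)"
  by (simp add: cinner_def mult.commute)

lemma da_kernel_norm:
  assumes "x \<in> ball 0 1"
  shows "(space_norm drury_arveson (da_kernel_at x))\<^sup>2 = 1 / (1 - (norm x)\<^sup>2)"
proof -
  have "of_real ((space_norm drury_arveson (da_kernel_at x))\<^sup>2) = da_kernel_at x x"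
    using da.inner_self[OF kernel_in_da[OF assms]] da_reproducing[OF kernel_in_da[OF assms] assms] by simp
  also have "\<dots> = complex_of_real (1 / (1 - (norm x)\<^sup>2))"
    using assms by (simp add: restrict0_def da_kernel_def cinner_self)
  finally show ?thesis
    using of_real_eq_iff by blast
qed

lemma scaled_kernel_in_span:
  "x \<in> V \<Longrightarrow> V \<subseteq> ball 0 1 \<Longrightarrow> (\<lambda>z. c * da_kernel_at x z) \<in> kernel_span V"
  unfolding kernel_span_def closed_span_def
proof (intro CollectI conjI allI impI)
  assume x: "x \<in> V" "V \<subseteq> ball 0 1"
  have k: "(\<lambda>z. c * da_kernel_at x z) \<in> cfun.span (da_kernel_at ` V)"
    using x by (intro cfun.span_scale cfun.span_base) simp
  then show in_H: "(\<lambda>z. c * da_kernel_at x z) \<in> space_carrier drury_arveson"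
    using da.span_in[OF kernels_subset[OF x(2)]] by blast
  fix e :: real assume "0 < e"
  then show "\<exists>k\<in>cfun.span (da_kernel_at ` V).
      space_norm drury_arveson ((\<lambda>z. c * da_kernel_at x z) - k) < e"
    using k by (intro bexI[of _ "\<lambda>z. c * da_kernel_at x z"]) simp_all
qed

text \<open>
  A multiplier \<open>\<phi>\<close> has almost equal values at points whose kernel functions almost point in
  the same direction. With \<open>u\<close> the normalised kernel function at \<open>x\<close>, pair \<open>\<phi> * u\<close>
  with the component of \<open>u\<close> orthogonal to the kernel function at \<open>y\<close>: the pairing equals
  \<open>\<phi> x - t * \<phi> y\<close>, where \<open>t\<close> is the squared cosine, and that component has norm
  \<open>sqrt (1 - t)\<close>.
\<close>

lemma multiplier_variation:
  assumes V: "V \<subseteq> ball 0 1" and \<phi>: "\<phi> \<in> variety_multipliers V"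
    and C: "mult_norm (variety_space V) \<phi> \<le> ennreal C" "0 \<le> C" and xy: "x \<in> V" "y \<in> V"
  shows "cmod (\<phi> x - \<phi> y) \<le> C * (sqrt (1 - kernel_cos2 x y) + (1 - kernel_cos2 x y))"
proof -
  let ?t = "kernel_cos2 x y"
  have ball: "x \<in> ball 0 1" "y \<in> ball 0 1"
    using xy V by auto
  define nx where "nx = space_norm drury_arveson (da_kernel_at x)"
  define ny where "ny = space_norm drury_arveson (da_kernel_at y)"
  have pos: "0 < 1 - (norm x)\<^sup>2" "0 < 1 - (norm y)\<^sup>2"
    using ball by (simp_all add: power_less_one_iff)
  have sq: "nx\<^sup>2 = 1 / (1 - (norm x)\<^sup>2)" "ny\<^sup>2 = 1 / (1 - (norm y)\<^sup>2)"
    unfolding nx_def ny_def using da_kernel_norm ball by auto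
  have "0 \<le> nx" "0 \<le> ny"
    unfolding nx_def ny_def by (intro da.norm_ge_0 kernel_in_da ball)+
  moreover have "nx \<noteq> 0" "ny \<noteq> 0"
    using sq pos by auto
  ultimately have n: "0 < nx" "0 < ny"
    by auto
  note kH = kernel_in_da[OF ball(1)] kernel_in_da[OF ball(2)]
  have bound_y: "cmod (\<phi> y) \<le> C"
  proof -
    let ?v = "\<lambda>z. of_real (1 / ny) * da_kernel_at y z"
    have "space_norm drury_arveson ?v \<le> 1"
      unfolding da.norm_scale[OF kH(2)] ny_def[symmetric] using n by (simp add: norm_divide)
    then obtain p where p: "p \<in> space_carrier drury_arveson" "space_norm drury_arveson p \<le> C"
      "p y = \<phi> y * ?v y"
      using variety_multiplier_apply[OF V \<phi> C scaled_kernel_in_span[OF xy(2) V]] xy(2) by metis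
    have "?v y = of_real (1 / ny) * of_real (ny\<^sup>2)"
      unfolding sq using ball by (simp add: restrict0_def da_kernel_def cinner_self)
    then have "?v y = of_real ny"
      using n by (simp add: power2_eq_square)
    then have "cmod (\<phi> y) * ny = cmod (inner_prod drury_arveson p (da_kernel_at y))"
      unfolding da_reproducing[OF p(1) ball(2)] p(3) using n by (simp add: norm_mult)
    also have "\<dots> \<le> C * ny"
      using da.Cauchy_Schwarz[OF p(1) kH(2)] p(2) n unfolding ny_def[symmetric]
      by (meson less_imp_le mult_right_mono order_trans)
    finally show ?thesis
      using n by simp
  qed
  define u where "u = (\<lambda>z. of_real (1 / nx) * da_kernel_at x z)"
  have uH: "u \<in> space_carrier drury_arveson"
    unfolding u_def by (rule da.scale_in[OF kH(1)])
  have u_norm: "space_norm drury_arveson u = 1"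
    unfolding u_def da.norm_scale[OF kH(1)] nx_def[symmetric] using n by (simp add: norm_divide)
  obtain p where p: "p \<in> space_carrier drury_arveson" "space_norm drury_arveson p \<le> C"
    "\<And>z. z \<in> V \<Longrightarrow> p z = \<phi> z * u z"
    using variety_multiplier_apply[OF V \<phi> C scaled_kernel_in_span[OF xy(1) V], of "of_real (1 / nx)"]
      u_norm unfolding u_def by (metis order_refl)
  have ux: "u x = of_real nx"
  proof -
    have "u x = of_real (1 / nx) * of_real (nx\<^sup>2)"
      unfolding sq u_def using ball by (simp add: restrict0_def da_kernel_def cinner_self)
    then show ?thesis
      using n by (simp add: power2_eq_square)
  qed
  have uy: "u y = of_real (1 / nx) / cnj (1 - cinner x y)"
    unfolding u_def using ball
    by (simp add: restrict0_def da_kernel_def cinner_commute[of y x])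
  define c where "c = inner_prod drury_arveson u (da_kernel_at y) / of_real (ny\<^sup>2)"
  have c: "c = u y / of_real (ny\<^sup>2)"
    unfolding c_def da_reproducing[OF uH ball(2)] ..
  have t: "(cmod (u y))\<^sup>2 / ny\<^sup>2 = ?t"
  proof -
    have "(cmod (u y))\<^sup>2 / ny\<^sup>2 = 1 / (nx\<^sup>2 * ny\<^sup>2 * (cmod (1 - cinner x y))\<^sup>2)"
      unfolding uy norm_divide complex_mod_cnj using n by (simp add: power_divide norm_divide power_mult_distrib)
    then show ?thesis
      unfolding sq kernel_cos2_def by simp
  qed
  \<comment> \<open>the component of \<open>u\<close> orthogonal to the kernel function at \<open>y\<close>\<close>
  let ?e = "u - (\<lambda>z. c * da_kernel_at y z)"
  have eH: "?e \<in> space_carrier drury_arveson"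
    using uH kH by simp
  have e_norm: "(space_norm drury_arveson ?e)\<^sup>2 = 1 - ?t"
    using da.norm_sq_diff_scale[OF uH kH(2)] n t u_norm da_reproducing[OF uH ball(2)]
    unfolding ny_def[symmetric] c_def by simp
  then have t_le: "0 \<le> 1 - ?t" and e_sqrt: "space_norm drury_arveson ?e = sqrt (1 - ?t)"
    using da.norm_ge_0[OF eH] by (metis zero_le_power2, metis real_sqrt_unique)
  have "inner_prod drury_arveson p ?e = inner_prod drury_arveson p u - cnj c * p y"
    using p(1) uH kH ball by (simp add: da.inner_diff_right da.inner_scale_right da_reproducing)
  also have "inner_prod drury_arveson p u = of_real (1 / nx) * p x"
    unfolding u_def da.inner_scale_right[OF kH(1) p(1)] da_reproducing[OF p(1) ball(1)] by simp
  also have "of_real (1 / nx) * p x = \<phi> x"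
    using p(3)[OF xy(1)] ux n by simp
  also have "cnj c * p y = of_real ?t * \<phi> y"
  proof -
    have "cnj c * p y = (u y * cnj (u y)) / of_real (ny\<^sup>2) * \<phi> y"
      unfolding c p(3)[OF xy(2)] by simp
    then show ?thesis
      unfolding t[symmetric] complex_norm_square[symmetric] of_real_divide .
  qed
  finally have pairing: "inner_prod drury_arveson p ?e = \<phi> x - of_real ?t * \<phi> y" .
  have "cmod (\<phi> x - of_real ?t * \<phi> y) \<le> space_norm drury_arveson p * sqrt (1 - ?t)"
    using da.Cauchy_Schwarz[OF p(1) eH] unfolding pairing e_sqrt .
  also have "\<dots> \<le> C * sqrt (1 - ?t)"
    using p(2) t_le by (intro mult_right_mono) auto
  finally have 1: "cmod (\<phi> x - of_real ?t * \<phi> y) \<le> C * sqrt (1 - ?t)" .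
  have "\<phi> x - \<phi> y = (\<phi> x - of_real ?t * \<phi> y) - of_real (1 - ?t) * \<phi> y"
    by (simp add: algebra_simps)
  then have "cmod (\<phi> x - \<phi> y) \<le> cmod (\<phi> x - of_real ?t * \<phi> y) + (1 - ?t) * cmod (\<phi> y)"
    using norm_triangle_ineq4[of "\<phi> x - of_real ?t * \<phi> y" "of_real (1 - ?t) * \<phi> y"] t_le
    by (simp only: norm_mult norm_of_real abs_of_nonneg)
  also have "\<dots> \<le> C * sqrt (1 - ?t) + (1 - ?t) * C"
    using 1 bound_y t_le by (intro add_mono mult_left_mono) auto
  finally show ?thesis
    by (simp add: algebra_simps)
qed

section \<open>First-order behaviour of an embedding map at the circle\<close>

text \<open>
  Near \<open>\<xi>\<close> the derivative of \<open>G z = F z - g \<xi> * z\<close> is small, so on the convex part of the open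
  disc near \<open>\<xi>\<close> the increments of \<open>G\<close> are small compared to those of \<open>z\<close>. Shrinking
  both points towards the origin carries this estimate to the closed disc.
\<close>

lemma holomorphic_disc_boundary_derivative:
  fixes F g :: "complex \<Rightarrow> complex"
  assumes F: "F holomorphic_on ball 0 1" "continuous_on (cball 0 1) F"
    and g: "continuous_on (cball 0 1) g" "\<And>z. z \<in> ball 0 1 \<Longrightarrow> g z = deriv F z"
    and \<xi>: "\<xi> \<in> cball 0 1"
  shows "(F has_field_derivative g \<xi>) (at \<xi> within cball 0 1)"
  unfolding has_field_derivative_def has_derivative_within_alt
proof (intro conjI allI impI)
  show "bounded_linear ((*) (g \<xi>))"
    by (rule bounded_linear_mult_right)
  fix e :: real assume "0 < e"
  then obtain d where d: "0 < d" "\<And>z. z \<in> cball 0 1 \<Longrightarrow> dist z \<xi> < d \<Longrightarrow> dist (g z) (g \<xi>) < e"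
    using g(1) \<xi> unfolding continuous_on_iff by metis
  define G where "G z = F z - g \<xi> * z" for z
  let ?S = "ball 0 1 \<inter> ball \<xi> d"
  have bound: "cmod (G a - G b) \<le> e * cmod (a - b)" if "a \<in> ?S" "b \<in> ?S" for a b
  proof (rule field_differentiable_bound[of ?S])
    show "convex ?S"
      by (intro convex_Int convex_ball)
    fix z assume z: "z \<in> ?S"
    have "(F has_field_derivative deriv F z) (at z)"
      using holomorphic_derivI[OF F(1) open_ball] z by blast
    then show "(G has_field_derivative (g z - g \<xi>)) (at z within ?S)"
      unfolding G_def using g(2)[of z] z
      by (auto intro!: derivative_eq_intros elim: has_field_derivative_at_within)
    show "cmod (g z - g \<xi>) \<le> e"
      using d(2)[of z] z by (simp add: dist_norm norm_minus_commute)
  qed (use that in auto)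
  have cont: "continuous_on (cball 0 1) G"
    unfolding G_def by (intro continuous_intros F)
  define r :: "nat \<Rightarrow> complex" where "r n = of_real (1 - inverse (real (Suc n)))" for n
  have r_lim: "r \<longlonglongrightarrow> 1"
    using tendsto_of_real[OF tendsto_diff[OF tendsto_const[of 1] LIMSEQ_inverse_real_of_nat], where ?'a = complex]
    by (simp add: r_def[abs_def])
  have r_norm: "cmod (r n) < 1" for n
    unfolding r_def norm_of_real by (simp add: field_simps)
  have ry_lim: "(\<lambda>n. r n * y) \<longlonglongrightarrow> y" for y
    using tendsto_mult_right[OF r_lim, of y] by simp
  have ry_ball: "r n * y \<in> ball 0 1" if "y \<in> cball 0 1" for n y
    using that r_norm[of n] mult_le_one mult_strict_mono'[of "cmod (r n)" 1 "cmod y" 1]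
      mult_left_le[of "cmod y" "cmod (r n)"] by (simp add: norm_mult)
  have G_lim: "(\<lambda>n. G (r n * y)) \<longlonglongrightarrow> G y" if "y \<in> cball 0 1" for y
    using continuous_on_tendsto_compose[OF cont ry_lim that] ry_ball[OF that]
    by (simp add: less_imp_le)
  show "\<exists>d>0. \<forall>y\<in>cball 0 1. norm (y - \<xi>) < d \<longrightarrow>
      norm (F y - F \<xi> - g \<xi> * (y - \<xi>)) \<le> e * norm (y - \<xi>)"
  proof (intro exI[of _ d] conjI ballI impI d(1))
    fix y assume y: "y \<in> cball 0 1" "norm (y - \<xi>) < d"
    have "norm (G y - G \<xi>) \<le> e * norm (y - \<xi>)"
    proof (rule LIMSEQ_le)
      show "(\<lambda>n. norm (G (r n * y) - G (r n * \<xi>))) \<longlonglongrightarrow> norm (G y - G \<xi>)"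
        by (intro tendsto_intros G_lim y \<xi>)
      show "(\<lambda>n. e * norm (r n * y - r n * \<xi>)) \<longlonglongrightarrow> e * norm (y - \<xi>)"
        by (intro tendsto_intros ry_lim)
      have near: "\<forall>\<^sub>F n in sequentially. dist (r n * x) \<xi> < d" if "dist x \<xi> < d" for x
        using order_tendstoD(2)[OF tendsto_dist[OF ry_lim tendsto_const] that] .
      have "\<forall>\<^sub>F n in sequentially. norm (G (r n * y) - G (r n * \<xi>)) \<le> e * norm (r n * y - r n * \<xi>)"
      proof (rule eventually_mono[OF eventually_conj[OF near[of y] near[of \<xi>]]])
        fix n assume n: "dist (r n * y) \<xi> < d \<and> dist (r n * \<xi>) \<xi> < d"
        show "norm (G (r n * y) - G (r n * \<xi>)) \<le> e * norm (r n * y - r n * \<xi>)"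
          by (rule bound) (use n ry_ball[OF y(1)] ry_ball[OF \<xi>] in \<open>auto simp: dist_commute\<close>)
      qed (use y(2) d(1) in \<open>auto simp: dist_norm\<close>)
      then show "\<exists>N. \<forall>n\<ge>N. norm (G (r n * y) - G (r n * \<xi>)) \<le> e * norm (r n * y - r n * \<xi>)"
        by (simp add: eventually_sequentially)
    qed
    moreover have "G y - G \<xi> = F y - F \<xi> - g \<xi> * (y - \<xi>)"
      by (simp add: G_def algebra_simps)
    ultimately show "norm (F y - F \<xi> - g \<xi> * (y - \<xi>)) \<le> e * norm (y - \<xi>)"
      by simp
  qed
qed

lemma disc_embedding_boundary_derivative:
  assumes f: "disc_embedding V f" and \<xi>: "\<xi> \<in> sphere 0 1"
  shows "((\<lambda>z. f z $ j) has_field_derivative disc_deriv f \<xi> $ j) (at \<xi> within cball 0 1)"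
proof -
  have hol: "(\<lambda>z. f z $ j) holomorphic_on ball 0 1" and C2: "C2_closed_disc f"
    using f by (simp_all add: disc_embedding_def)
  have cont: "continuous_on (cball 0 1) (\<lambda>z. f z $ j)"
    using C2 by (auto simp: C2_closed_disc_def intro!: continuous_intros)
  have "\<forall>k\<in>{1, 2}. \<exists>g. continuous_on (cball 0 1) g \<and>
      (\<forall>z\<in>ball 0 1. g z = (deriv ^^ k) (\<lambda>w. f w $ j) z)"
    using C2 unfolding C2_closed_disc_def by blast
  from bspec[OF this, of 1] obtain g where g: "continuous_on (cball 0 1) g"
    "\<And>z. z \<in> ball 0 1 \<Longrightarrow> g z = deriv (\<lambda>w. f w $ j) z"
    by auto
  have \<xi>': "\<xi> \<in> cball 0 1"
    using \<xi> by simp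
  have "(g \<longlongrightarrow> g \<xi>) (at \<xi> within cball 0 1)"
    using g(1) \<xi>' by (simp add: continuous_on_def)
  then have "(g \<longlongrightarrow> g \<xi>) (at \<xi> within ball 0 1)"
    by (rule tendsto_within_subset) (rule ball_subset_cball)
  moreover have "\<forall>\<^sub>F z in at \<xi> within ball 0 1. g z = deriv (\<lambda>w. f w $ j) z"
    using g(2) by (auto simp: eventually_at_filter)
  ultimately have "(deriv (\<lambda>w. f w $ j) \<longlongrightarrow> g \<xi>) (at \<xi> within ball 0 1)"
    by (rule Lim_transform_eventually)
  moreover have "\<not> trivial_limit (at \<xi> within ball 0 1)"
    using \<xi>' by (simp add: trivial_limit_within islimpt_ball)
  ultimately have "Lim (at \<xi> within ball 0 1) (deriv (\<lambda>w. f w $ j)) = g \<xi>"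
    by (intro tendsto_Lim)
  then show ?thesis
    using holomorphic_disc_boundary_derivative[OF hol cont g \<xi>'] by (simp add: disc_deriv_def)
qed

text \<open>
  Every first-order expansion below is an instance of this product rule along two curves in the
  closed disc: the radii, and the circle itself.
\<close>

lemma cinner_along_curves:
  fixes f :: "complex \<Rightarrow> complex ^ 'n" and \<gamma> \<delta> :: "real \<Rightarrow> complex"
  assumes f: "disc_embedding V f"
    and \<gamma>: "(\<gamma> has_vector_derivative \<gamma>') (at 0 within T)" "\<gamma> ` T \<subseteq> cball 0 1" "\<gamma> 0 \<in> sphere 0 1"
    and \<delta>: "(\<delta> has_vector_derivative \<delta>') (at 0 within T)" "\<delta> ` T \<subseteq> cball 0 1" "\<delta> 0 \<in> sphere 0 1"
  shows "((\<lambda>t. cinner (f (\<gamma> t)) (f (\<delta> t))) has_vector_derivative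
      cinner (f (\<gamma> 0)) (\<delta>' *s disc_deriv f (\<delta> 0)) + cinner (\<gamma>' *s disc_deriv f (\<gamma> 0)) (f (\<delta> 0)))
      (at 0 within T)"
proof -
  have comp: "((\<lambda>t. f (\<epsilon> t) $ j) has_vector_derivative \<epsilon>' * disc_deriv f (\<epsilon> 0) $ j) (at 0 within T)"
    if "(\<epsilon> has_vector_derivative \<epsilon>') (at 0 within T)" "\<epsilon> ` T \<subseteq> cball 0 1" "\<epsilon> 0 \<in> sphere 0 1"
    for \<epsilon> \<epsilon>' j
    using field_vector_diff_chain_within[OF that(1)
        has_field_derivative_subset[OF disc_embedding_boundary_derivative[OF f that(3)] that(2)]]
    by (simp add: o_def)
  have cnj: "((\<lambda>t. cnj (X t)) has_vector_derivative cnj X') (at 0 within T)"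
    if "(X has_vector_derivative X') (at 0 within T)" for X X'
    using bounded_linear.has_vector_derivative[OF bounded_linear_cnj that] .
  have "((\<lambda>t. \<Sum>j\<in>UNIV. f (\<gamma> t) $ j * cnj (f (\<delta> t) $ j)) has_vector_derivative
      (\<Sum>j\<in>UNIV. f (\<gamma> 0) $ j * cnj (\<delta>' * disc_deriv f (\<delta> 0) $ j) +
        \<gamma>' * disc_deriv f (\<gamma> 0) $ j * cnj (f (\<delta> 0) $ j))) (at 0 within T)"
    by (intro has_vector_derivative_sum has_vector_derivative_mult comp[OF \<gamma>] cnj[OF comp[OF \<delta>]])
  then show ?thesis
    by (simp add: cinner_def sum.distrib)
qed

lemma cinner_scale_left: "cinner (a *s x) y = a * cinner x y"
  by (simp add: cinner_def sum_distrib_left mult.assoc)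

lemma cinner_scale_right: "cinner x (a *s y) = cnj a * cinner x y"
  by (simp add: cinner_def sum_distrib_left mult_ac)

lemma A_coeff_eq: "A_coeff f \<xi> = cnj \<xi> * cinner (f \<xi>) (disc_deriv f \<xi>)"
  by (simp add: A_coeff_def cinner_scale_right)

lemma A_coeff_cnj: "cnj (A_coeff f \<xi>) = \<xi> * cinner (disc_deriv f \<xi>) (f \<xi>)"
  by (simp add: A_coeff_eq cinner_commute[of "disc_deriv f \<xi>"])

lemma disc_embedding_sphere: "disc_embedding V f \<Longrightarrow> \<xi> \<in> sphere 0 1 \<Longrightarrow> norm (f \<xi>) = 1"
  by (simp add: disc_embedding_def)

lemma disc_embedding_ball: "disc_embedding V f \<Longrightarrow> z \<in> ball 0 1 \<Longrightarrow> f z \<in> ball 0 1"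
  unfolding disc_embedding_def by blast

lemma has_vector_derivative_cis0: "(cis has_vector_derivative \<i>) (at 0)"
  using has_derivative_cis[OF has_derivative_ident, of "0 :: real" UNIV]
  by (simp add: has_vector_derivative_def scaleR_conv_of_real mult_ac)

text \<open>Along the circle \<open>\<parallel>f\<parallel>\<close> is constant, so its tangential derivative vanishes.\<close>

lemma A_coeff_real:
  assumes f: "disc_embedding V f" and \<xi>: "\<xi> \<in> sphere 0 1"
  shows "A_coeff f \<xi> \<in> \<real>"
proof -
  let ?\<gamma> = "\<lambda>t. \<xi> * cis t"
  have circle: "?\<gamma> t \<in> sphere 0 1" for t
    using \<xi> by (simp add: norm_mult)
  have deriv: "(?\<gamma> has_vector_derivative \<xi> * \<i>) (at 0)"
    using has_vector_derivative_mult_right[OF has_vector_derivative_cis0] by simp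
  have const: "cinner (f (?\<gamma> t)) (f (?\<gamma> t)) = 1" for t
    using disc_embedding_sphere[OF f circle] by (simp add: cinner_self)
  let ?D = "cinner (f \<xi>) ((\<xi> * \<i>) *s disc_deriv f \<xi>) + cinner ((\<xi> * \<i>) *s disc_deriv f \<xi>) (f \<xi>)"
  have "((\<lambda>t. cinner (f (?\<gamma> t)) (f (?\<gamma> t))) has_vector_derivative ?D) (at 0)"
    using cinner_along_curves[OF f deriv _ _ deriv] circle[unfolded sphere_def] \<xi>
    by (simp add: image_subset_iff norm_mult)
  then have "((\<lambda>t::real. 1::complex) has_vector_derivative ?D) (at 0)"
    unfolding const .
  then have "?D = 0"
    using vector_derivative_unique_at has_vector_derivative_const by blast
  moreover have "?D = \<i> * (cnj (A_coeff f \<xi>) - A_coeff f \<xi>)"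
    unfolding right_diff_distrib A_coeff_cnj unfolding A_coeff_eq cinner_scale_left cinner_scale_right
    by simp
  ultimately have "cnj (A_coeff f \<xi>) = A_coeff f \<xi>"
    by simp
  then show ?thesis
    by (simp add: Reals_cnj_iff)
qed

text \<open>
  By \<open>f \<xi> = f \<zeta>\<close> the first-order terms pair each derivative with the value of \<open>f\<close> at the
  same boundary point, so they are the coefficients at \<open>\<xi>\<close> and \<open>\<zeta>\<close>. The case
  \<open>\<xi> = \<zeta>\<close> covers the norm, and \<open>b = 0\<close> keeps the second point fixed on the sphere.
\<close>

lemma radial_expansion:
  assumes f: "disc_embedding V f" and \<xi>: "\<xi> \<in> sphere 0 1" and \<zeta>: "\<zeta> \<in> sphere 0 1"
    and eq: "f \<xi> = f \<zeta>" and ab: "0 \<le> a" "0 \<le> b"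
  shows "((\<lambda>s. (1 - cinner (f (of_real (1 - a * s) * \<xi>)) (f (of_real (1 - b * s) * \<zeta>))) / of_real s)
      \<longlongrightarrow> of_real a * A_coeff f \<xi> + of_real b * A_coeff f \<zeta>) (at_right 0)"
proof -
  let ?\<gamma> = "\<lambda>c \<eta> s. of_real (1 - c * s) * \<eta> :: complex"
  define T where "T = {s. 0 \<le> s \<and> s * a \<le> 1 \<and> s * b \<le> 1}"
  have deriv: "(?\<gamma> c \<eta> has_vector_derivative - of_real c * \<eta>) (at 0 within T)" for c \<eta>
    by (auto intro!: derivative_eq_intros simp: has_vector_derivative_def scaleR_conv_of_real)
  have maps: "?\<gamma> c \<eta> ` T \<subseteq> cball 0 1" if "\<eta> \<in> sphere 0 1" "0 \<le> c" "c = a \<or> c = b" for c \<eta>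
    using that by (auto simp: T_def norm_mult mult.commute simp del: of_real_diff of_real_mult)
  let ?h = "\<lambda>s. cinner (f (?\<gamma> a \<xi> s)) (f (?\<gamma> b \<zeta> s))"
  let ?D = "of_real a * A_coeff f \<xi> + of_real b * A_coeff f \<zeta>"
  have h0: "?h 0 = 1"
    using disc_embedding_sphere[OF f \<zeta>] eq by (simp add: cinner_self)
  have D: "cinner (f \<xi>) ((- of_real b * \<zeta>) *s disc_deriv f \<zeta>) +
      cinner ((- of_real a * \<xi>) *s disc_deriv f \<xi>) (f \<zeta>) = - ?D"
  proof -
    have "cinner ((- of_real a * \<xi>) *s disc_deriv f \<xi>) (f \<zeta>) = - of_real a * cnj (A_coeff f \<xi>)"
      unfolding A_coeff_cnj cinner_scale_left by (simp add: eq)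
    also have "\<dots> = - of_real a * A_coeff f \<xi>"
      using A_coeff_real[OF f \<xi>] by (simp add: Reals_cnj_iff)
    finally show ?thesis
      unfolding eq cinner_scale_right A_coeff_eq by simp
  qed
  have "(?h has_vector_derivative - ?D) (at 0 within T)"
    using cinner_along_curves[OF f deriv maps[OF \<xi> ab(1)] _ deriv maps[OF \<zeta> ab(2)]] \<xi> \<zeta>
    unfolding D[symmetric] by simp
  then have lim: "((\<lambda>s. (1 / norm (s - 0)) *\<^sub>R (?h s - (?h 0 + (s - 0) *\<^sub>R (- ?D)))) \<longlongrightarrow> 0) (at 0 within T)"
    unfolding has_vector_derivative_def has_derivative_within by (rule conjunct2)
  define d where "d = 1 / (1 + a + b)"
  have d: "0 < d"
    using ab by (simp add: d_def)
  have "s \<in> T" if "s \<in> {0..d}" for s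
  proof -
    have "s * (1 + a + b) \<le> 1"
      using that ab by (simp add: d_def field_simps)
    moreover have "0 \<le> s * a" "0 \<le> s * b" "0 \<le> s"
      using that ab by auto
    ultimately show ?thesis
      by (auto simp: T_def distrib_left)
  qed
  then have "{0..d} \<subseteq> T"
    by blast
  from tendsto_within_subset[OF lim this]
  have "((\<lambda>s. (1 / norm (s - 0)) *\<^sub>R (?h s - (?h 0 + (s - 0) *\<^sub>R (- ?D)))) \<longlongrightarrow> 0) (at_right 0)"
    unfolding at_within_Icc_at_right[OF d] .
  from tendsto_minus[OF this]
  have lim': "((\<lambda>s. - ((1 / norm (s - 0)) *\<^sub>R (?h s - (?h 0 + (s - 0) *\<^sub>R (- ?D))))) \<longlongrightarrow> 0) (at_right 0)"
    by simp
  have "\<forall>\<^sub>F s in at_right 0. - ((1 / norm (s - 0)) *\<^sub>R (?h s - (?h 0 + (s - 0) *\<^sub>R (- ?D)))) =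
      (1 - ?h s) / of_real s - ?D"
  proof (rule eventually_at_rightI[OF _ zero_less_one])
    fix s :: real assume s: "s \<in> {0<..<1}"
    have "- ((1 / s) *\<^sub>R (x - (1 + s *\<^sub>R (- ?D)))) = (1 - x) / of_real s - ?D" for x
      using s by (simp add: scaleR_conv_of_real field_simps)
    then show "- ((1 / norm (s - 0)) *\<^sub>R (?h s - (?h 0 + (s - 0) *\<^sub>R (- ?D)))) = (1 - ?h s) / of_real s - ?D"
      unfolding h0 using s by simp
  qed
  from Lim_transform_eventually[OF lim' this]
  have "((\<lambda>s. (1 - ?h s) / of_real s - ?D) \<longlongrightarrow> 0) (at_right 0)" .
  then show ?thesis
    by (rule LIM_zero_cancel)
qed


lemma disc_automorphism_identity:
  "(cmod (1 - cnj b * h))\<^sup>2 - (cmod (h - b))\<^sup>2 = (1 - (cmod b)\<^sup>2) * (1 - (cmod h)\<^sup>2)"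
  unfolding cmod_power2 by (simp add: power2_eq_square algebra_simps)

text \<open>
  This is the boundary lemma of Hopf: by the Schwarz lemma, applied after an automorphism of the
  disc has moved \<open>h 0\<close> to the origin, \<open>h z\<close> cannot approach the circle faster than linearly.
\<close>

lemma holomorphic_self_map_linear_decay:
  assumes h: "h holomorphic_on ball 0 1" "\<And>z. z \<in> ball 0 1 \<Longrightarrow> cmod (h z) < 1"
    and z: "cmod z < 1"
  shows "(1 - cmod z) * (1 - cmod (h 0))\<^sup>2 / 2 \<le> 1 - cmod (h z)"
proof -
  define b where "b = h 0"
  have b: "cmod b < 1"
    using h(2)[of 0] by (simp add: b_def)
  have prod: "cmod (cnj b * h z) \<le> cmod b" if "cmod z < 1" for z
    using h(2)[of z] that mult_left_le[of "cmod (h z)" "cmod b"] by (simp add: norm_mult)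
  have den: "1 - cmod b \<le> cmod (1 - cnj b * h z)" if "cmod z < 1" for z
    using prod[OF that] norm_triangle_ineq2[of 1 "cnj b * h z"] by simp
  define F where "F z = (h z - b) / (1 - cnj b * h z)" for z
  have den_pos: "0 < cmod (1 - cnj b * h z)" if "cmod z < 1" for z
    using den[OF that] b by linarith
  have F_hol: "F holomorphic_on ball 0 1"
    unfolding F_def using den_pos by (intro holomorphic_intros h(1)) auto
  have F_0: "F 0 = 0"
    by (simp add: F_def b_def)
  have F_less: "cmod (F z) < 1" if "cmod z < 1" for z
  proof -
    have "0 < (1 - (cmod b)\<^sup>2) * (1 - (cmod (h z))\<^sup>2)"
      using b h(2)[of z] that by (simp add: power_less_one_iff)
    then have "(cmod (h z - b))\<^sup>2 < (cmod (1 - cnj b * h z))\<^sup>2"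
      using disc_automorphism_identity[of b "h z"] by linarith
    then have "cmod (h z - b) < cmod (1 - cnj b * h z)"
      by (rule power2_less_imp_less) simp
    then show ?thesis
      using den_pos[OF that] by (simp add: F_def norm_divide)
  qed
  have "cmod (F z) \<le> cmod z"
    using Schwarz_Lemma(1)[OF F_hol F_0 F_less z] .
  then have "cmod (h z - b) \<le> cmod z * cmod (1 - cnj b * h z)"
    using den_pos[OF z] by (simp add: F_def norm_divide pos_divide_le_eq)
  then have "(cmod (h z - b))\<^sup>2 \<le> (cmod z)\<^sup>2 * (cmod (1 - cnj b * h z))\<^sup>2"
    unfolding power_mult_distrib[symmetric] by (rule power_mono) simp
  then have 1: "(1 - (cmod z)\<^sup>2) * (cmod (1 - cnj b * h z))\<^sup>2 \<le> (1 - (cmod b)\<^sup>2) * (1 - (cmod (h z))\<^sup>2)"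
    using disc_automorphism_identity[of b "h z"] by (simp add: left_diff_distrib)
  have "(1 - cmod z) * (1 - cmod b)\<^sup>2 \<le> (1 - (cmod z)\<^sup>2) * (cmod (1 - cnj b * h z))\<^sup>2"
  proof (intro mult_mono power_mono den z)
    show "1 - cmod z \<le> 1 - (cmod z)\<^sup>2"
      using z mult_left_le[of "cmod z" "cmod z"] by (simp add: power2_eq_square)
  qed (use z b in \<open>auto simp: power_le_one\<close>)
  also note 1
  also have "(1 - (cmod b)\<^sup>2) * (1 - (cmod (h z))\<^sup>2) \<le> 1 * (2 * (1 - cmod (h z)))"
  proof (intro mult_mono)
    have "0 \<le> (1 - cmod (h z))\<^sup>2"
      by simp
    then show "1 - (cmod (h z))\<^sup>2 \<le> 2 * (1 - cmod (h z))"
      by (simp add: power2_eq_square algebra_simps)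
  qed (use h(2)[of z] z in \<open>auto simp: power_le_one less_imp_le\<close>)
  finally show ?thesis
    by (simp add: b_def)
qed

text \<open>
  The function \<open>z \<mapsto> cinner (f z) (f \<xi>)\<close> maps the disc to itself and tends to \<open>1\<close> at
  \<open>\<xi>\<close>; \<open>A_coeff f \<xi>\<close> is the rate at which it does so along the radius, and the linear
  decay bounds this rate from below.
\<close>

lemma A_coeff_pos:
  assumes f: "disc_embedding V f" and \<xi>: "\<xi> \<in> sphere 0 1"
  obtains \<alpha> where "0 < \<alpha>" "A_coeff f \<xi> = of_real \<alpha>"
proof -
  define h where "h z = cinner (f z) (f \<xi>)" for z
  have "(\<lambda>z. f z $ j) holomorphic_on ball 0 1" for j
    using f by (simp add: disc_embedding_def)
  then have hol: "h holomorphic_on ball 0 1"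
    unfolding h_def cinner_def by (intro holomorphic_intros)
  have less: "cmod (h z) < 1" if "z \<in> ball 0 1" for z
    using cmod_cinner_le[of "f z" "f \<xi>"] disc_embedding_ball[OF f that] disc_embedding_sphere[OF f \<xi>]
    by (simp add: h_def)
  let ?k = "(1 - cmod (h 0))\<^sup>2 / 2"
  have lim: "((\<lambda>s. Re ((1 - h (of_real (1 - s) * \<xi>)) / of_real s)) \<longlongrightarrow> Re (A_coeff f \<xi>)) (at_right 0)"
    using tendsto_Re[OF radial_expansion[OF f \<xi> \<xi> refl, of 1 0]] by (simp add: h_def)
  have "\<forall>\<^sub>F s in at_right 0. ?k \<le> Re ((1 - h (of_real (1 - s) * \<xi>)) / of_real s)"
  proof (rule eventually_at_rightI[OF _ zero_less_one])
    fix s :: real assume s: "s \<in> {0<..<1}"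
    have z: "cmod (of_real (1 - s) * \<xi>) = 1 - s"
      unfolding norm_mult norm_of_real using \<xi> s by simp
    have "s * ?k \<le> 1 - cmod (h (of_real (1 - s) * \<xi>))"
      using holomorphic_self_map_linear_decay[OF hol less, of "of_real (1 - s) * \<xi>"] s
      unfolding z by simp
    also have "\<dots> \<le> 1 - Re (h (of_real (1 - s) * \<xi>))"
      using complex_Re_le_cmod by simp
    finally show "?k \<le> Re ((1 - h (of_real (1 - s) * \<xi>)) / of_real s)"
      using s by (simp add: Re_divide_of_real pos_le_divide_eq mult.commute del: of_real_diff)
  qed
  then have "?k \<le> Re (A_coeff f \<xi>)"
    by (rule tendsto_lowerbound[OF lim]) simp
  moreover have "0 < ?k"
    using less[of 0] by simp
  ultimately have "0 < Re (A_coeff f \<xi>)"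
    by linarith
  then show thesis
    using that[of "Re (A_coeff f \<xi>)"] A_coeff_real[OF f \<xi>] by (simp add: complex_is_Real_iff complex_eq_iff)
qed

section \<open>Comparison along two radii ending at a crossing point\<close>

lemma resolvent_multiplier_in: "0 < s \<Longrightarrow> norm q \<le> 1 \<Longrightarrow> resolvent_multiplier s q \<in> da_multipliers"
  using resolvent_multiplier_contraction(1)
  by (auto simp: da_multipliers_def Mult_def resolvent_multiplier_def restrict0_def)

lemma compose_inverse_at:
  assumes "disc_embedding V f" "z \<in> ball 0 1"
  shows "compose_inverse f \<phi> (f z) = \<phi> z"
proof -
  have "inj_on f (ball 0 1)"
    using assms(1) by (simp add: disc_embedding_def)
  then show ?thesis
    using assms(2) by (simp add: compose_inverse_def restrict0_def inv_into_f_f)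
qed

lemma disc_multiplier_variation:
  assumes f: "disc_embedding V f" and \<phi>: "\<phi> \<in> disc_multipliers f"
    and C: "disc_mult_norm f \<phi> \<le> ennreal C" "0 \<le> C" and zw: "z \<in> ball 0 1" "w \<in> ball 0 1"
  shows "cmod (\<phi> z - \<phi> w) \<le> C * (sqrt (1 - kernel_cos2 (f z) (f w)) + (1 - kernel_cos2 (f z) (f w)))"
proof -
  have ball: "f ` ball 0 1 \<subseteq> ball 0 1"
    using disc_embedding_ball[OF f] by blast
  show ?thesis
    using multiplier_variation[OF ball _ C(1)[unfolded disc_mult_norm_def] C(2), of "f z" "f w"] \<phi> zw
    by (simp add: disc_multipliers_def compose_inverse_at[OF f])
qed

definition pulled_back_resolvent :: "(complex \<Rightarrow> complex ^ 'n) \<Rightarrow> complex ^ 'n \<Rightarrow> real \<Rightarrow> complex \<Rightarrow> complex" where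
  "pulled_back_resolvent g q s = restrict0 (ball 0 1) (\<lambda>z. resolvent_multiplier s q (g z))"

lemma pulled_back_resolvent_multiplier:
  assumes g: "disc_embedding W g" and s: "0 < s" and q: "norm q \<le> 1"
  shows "pulled_back_resolvent g q s \<in> disc_multipliers g"
    "disc_mult_norm g (pulled_back_resolvent g q s) \<le> 1"
proof -
  have ball: "g ` ball 0 1 \<subseteq> ball 0 1"
    using disc_embedding_ball[OF g] by blast
  have eq: "compose_inverse g (pulled_back_resolvent g q s) = restrict0 (g ` ball 0 1) (resolvent_multiplier s q)"
  proof
    fix w
    show "compose_inverse g (pulled_back_resolvent g q s) w =
        restrict0 (g ` ball 0 1) (resolvent_multiplier s q) w"
    proof (cases "w \<in> g ` ball 0 1")
      case True
      then obtain z where z: "z \<in> ball 0 1" "w = g z"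
        by blast
      show ?thesis
        unfolding z(2) compose_inverse_at[OF g z(1)] using z by (simp add: pulled_back_resolvent_def restrict0_def)
    qed (simp add: compose_inverse_def restrict0_def)
  qed
  show "pulled_back_resolvent g q s \<in> disc_multipliers g"
    unfolding disc_multipliers_def variety_multipliers_def mem_Collect_eq eq
    using resolvent_multiplier_in[OF s q]
    by (intro conjI imageI) (simp_all add: pulled_back_resolvent_def restrict0_def)
  show "disc_mult_norm g (pulled_back_resolvent g q s) \<le> 1"
    unfolding disc_mult_norm_def eq
    by (rule mult_norm_restrict_le_1[OF ball]) (use resolvent_multiplier_contraction[OF s q] in auto)
qed

text \<open>
  With these rates \<open>1 - cinner x y\<close> and both \<open>1 - (norm x)\<^sup>2\<close> and \<open>1 - (norm y)\<^sup>2\<close>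
  agree to first order, so the two kernel functions align although both points run to the sphere.
\<close>

lemma kernel_cos2_tendsto_1:
  assumes f: "disc_embedding V f" and \<xi>: "\<xi> \<in> sphere 0 1" and \<zeta>: "\<zeta> \<in> sphere 0 1"
    and eq: "f \<xi> = f \<zeta>" and c: "0 \<le> c" and \<alpha>: "0 < \<alpha>" "A_coeff f \<xi> = of_real \<alpha>"
    and A: "of_real c * A_coeff f \<zeta> = A_coeff f \<xi>"
  shows "((\<lambda>s. kernel_cos2 (f (of_real (1 - s) * \<xi>)) (f (of_real (1 - c * s) * \<zeta>))) \<longlongrightarrow> 1) (at_right 0)"
proof -
  let ?x = "\<lambda>s. f (of_real (1 - s) * \<xi>)" and ?y = "\<lambda>s. f (of_real (1 - c * s) * \<zeta>)"
  have real: "(1 - cinner v v) / of_real s = complex_of_real ((1 - (norm v)\<^sup>2) / s)" for v :: "complex ^ 'a" and s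
    by (simp add: cinner_self)
  have "((\<lambda>s. complex_of_real ((1 - (norm (?x s))\<^sup>2) / s)) \<longlongrightarrow> of_real (2 * \<alpha>)) (at_right 0)"
    using radial_expansion[OF f \<xi> \<xi> refl, of 1 1] \<alpha> unfolding real[symmetric] by simp
  then have x: "((\<lambda>s. (1 - (norm (?x s))\<^sup>2) / s) \<longlongrightarrow> 2 * \<alpha>) (at_right 0)"
    unfolding tendsto_of_real_iff .
  have "((\<lambda>s. complex_of_real ((1 - (norm (?y s))\<^sup>2) / s)) \<longlongrightarrow> of_real (2 * \<alpha>)) (at_right 0)"
    using radial_expansion[OF f \<zeta> \<zeta> refl c c] \<alpha> A unfolding real[symmetric] by simp
  then have y: "((\<lambda>s. (1 - (norm (?y s))\<^sup>2) / s) \<longlongrightarrow> 2 * \<alpha>) (at_right 0)"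
    unfolding tendsto_of_real_iff .
  have "((\<lambda>s. (1 - cinner (?x s) (?y s)) / of_real s) \<longlongrightarrow> of_real (2 * \<alpha>)) (at_right 0)"
    using radial_expansion[OF f \<xi> \<zeta> eq, of 1 c] c \<alpha> A by simp
  then have xy: "((\<lambda>s. cmod ((1 - cinner (?x s) (?y s)) / of_real s)) \<longlongrightarrow> 2 * \<alpha>) (at_right 0)"
    using tendsto_norm[of _ "complex_of_real (2 * \<alpha>)"] \<alpha>(1) by fastforce
  have "((\<lambda>s. ((1 - (norm (?x s))\<^sup>2) / s) * ((1 - (norm (?y s))\<^sup>2) / s) /
      (cmod ((1 - cinner (?x s) (?y s)) / of_real s))\<^sup>2) \<longlongrightarrow> (2 * \<alpha>) * (2 * \<alpha>) / (2 * \<alpha>)\<^sup>2) (at_right 0)"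
    using \<alpha>(1) by (intro tendsto_intros x y xy) simp
  moreover have "\<forall>\<^sub>F s in at_right 0. ((1 - (norm (?x s))\<^sup>2) / s) * ((1 - (norm (?y s))\<^sup>2) / s) /
      (cmod ((1 - cinner (?x s) (?y s)) / of_real s))\<^sup>2 = kernel_cos2 (?x s) (?y s)"
    by (rule eventually_at_rightI[OF _ zero_less_one])
       (auto simp: kernel_cos2_def norm_divide power_divide power2_eq_square)
  ultimately have "((\<lambda>s. kernel_cos2 (?x s) (?y s)) \<longlongrightarrow> (2 * \<alpha>) * (2 * \<alpha>) / (2 * \<alpha>)\<^sup>2) (at_right 0)"
    by (rule Lim_transform_eventually)
  then show ?thesis
    using \<alpha>(1) by (simp add: power2_eq_square)
qed

lemma unit_vectors_cinner_1:
  assumes "norm x = 1" "norm y = 1" "cinner x y = 1"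
  shows "x = y"
proof -
  have "cinner (x - y) (x - y) = cinner x x - cinner x y - cinner y x + cinner y y"
    by (simp add: cinner_def algebra_simps sum.distrib sum_subtractf)
  then have "cinner (x - y) (x - y) = 0"
    using assms cinner_commute[of y x] by (simp add: cinner_self)
  then show ?thesis
    unfolding cinner_self by simp
qed

text \<open>
  The resolvents are scaled to the approach: \<open>s\<close> is both the resolvent parameter and the distance
  to the circle, so that the first-order coefficient at the circle survives in the limit.
\<close>

lemma resolvent_radial_limit:
  assumes g: "disc_embedding W g" and \<xi>: "\<xi> \<in> sphere 0 1" and \<zeta>: "\<zeta> \<in> sphere 0 1"
    and eq: "g \<xi> = g \<zeta>" and c: "0 \<le> c" and nz: "1 + of_real c * A_coeff g \<zeta> \<noteq> 0"
  shows "((\<lambda>s. of_real s / (of_real (1 + s) - cinner (g (of_real (1 - c * s) * \<zeta>)) (g \<xi>)))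
    \<longlongrightarrow> 1 / (1 + of_real c * A_coeff g \<zeta>)) (at_right 0)"
proof -
  let ?e = "\<lambda>s. (1 - cinner (g (of_real (1 - c * s) * \<zeta>)) (g \<xi>)) / of_real s"
  have lim: "(?e \<longlongrightarrow> of_real c * A_coeff g \<zeta>) (at_right 0)"
    using radial_expansion[OF g \<zeta> \<xi> eq[symmetric] c order_refl] by simp
  have "((\<lambda>s. 1 / (1 + ?e s)) \<longlongrightarrow> 1 / (1 + of_real c * A_coeff g \<zeta>)) (at_right 0)"
    by (intro tendsto_intros lim nz)
  moreover have "\<forall>\<^sub>F s in at_right 0. 1 / (1 + ?e s) =
      of_real s / (of_real (1 + s) - cinner (g (of_real (1 - c * s) * \<zeta>)) (g \<xi>))"
  proof (rule eventually_at_rightI[OF _ zero_less_one])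
    fix s :: real assume s: "s \<in> {0<..<1}"
    have "1 / (1 + (1 - x) / of_real s) = of_real s / (of_real (1 + s) - x)" for x :: complex
    proof -
      have "1 + (1 - x) / of_real s = (of_real (1 + s) - x) / of_real s"
        using s by (simp add: field_simps)
      then show ?thesis
        by simp
    qed
    then show "1 / (1 + ?e s) = of_real s / (of_real (1 + s) - cinner (g (of_real (1 - c * s) * \<zeta>)) (g \<xi>))" .
  qed
  ultimately show ?thesis
    by (rule Lim_transform_eventually)
qed

text \<open>
  Distinct points of the sphere keep \<open>cinner x q\<close> away from \<open>1\<close>, so the factor \<open>s\<close> of the
  scaled resolvent wins.
\<close>

lemma resolvent_limit_away:
  assumes g: "disc_embedding W g" and \<xi>: "\<xi> \<in> sphere 0 1" and \<zeta>: "\<zeta> \<in> sphere 0 1"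
    and neq: "g \<xi> \<noteq> g \<zeta>" and c: "0 < c"
  shows "((\<lambda>s. of_real s / (of_real (1 + s) - cinner (g (of_real (1 - c * s) * \<zeta>)) (g \<xi>)))
    \<longlongrightarrow> 0) (at_right 0)"
proof -
  have cont: "continuous_on (cball 0 1) g"
    using g by (simp add: disc_embedding_def C2_closed_disc_def)
  have "((\<lambda>s. of_real (1 - c * s) * \<zeta>) \<longlongrightarrow> of_real (1 - c * 0) * \<zeta>) (at_right 0)"
    by (intro tendsto_intros)
  moreover have "\<forall>\<^sub>F s in at_right 0. of_real (1 - c * s) * \<zeta> \<in> cball 0 1"
  proof (rule eventually_at_rightI)
    show "0 < 1 / c"
      using c by simp
    fix s assume "s \<in> {0<..<1 / c}"
    then have "0 < c * s" "c * s < 1"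
      using c by (auto simp: field_simps)
    then show "of_real (1 - c * s) * \<zeta> \<in> cball 0 1"
      using \<zeta> by (simp add: norm_mult del: of_real_diff of_real_mult)
  qed
  ultimately have "((\<lambda>s. g (of_real (1 - c * s) * \<zeta>)) \<longlongrightarrow> g \<zeta>) (at_right 0)"
    using continuous_on_tendsto_compose[OF cont, of "\<lambda>s. of_real (1 - c * s) * \<zeta>" \<zeta>] \<zeta> by simp
  then have inner: "((\<lambda>s. cinner (g (of_real (1 - c * s) * \<zeta>)) (g \<xi>)) \<longlongrightarrow> cinner (g \<zeta>) (g \<xi>)) (at_right 0)"
    unfolding cinner_def by (intro tendsto_intros)
  have nz: "of_real (1 + 0) - cinner (g \<zeta>) (g \<xi>) \<noteq> 0"
    using unit_vectors_cinner_1[OF disc_embedding_sphere[OF g \<zeta>] disc_embedding_sphere[OF g \<xi>]] neq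
    by auto
  have "((\<lambda>s. of_real s / (of_real (1 + s) - cinner (g (of_real (1 - c * s) * \<zeta>)) (g \<xi>)))
      \<longlongrightarrow> of_real 0 / (of_real (1 + 0) - cinner (g \<zeta>) (g \<xi>))) (at_right 0)"
    by (intro tendsto_intros inner nz)
  then show ?thesis
    by simp
qed

lemma equivalent_norms_bound:
  assumes "equal_with_equivalent_norms f g"
  obtains C where "0 < C"
    "\<And>\<phi>. \<phi> \<in> disc_multipliers g \<Longrightarrow> disc_mult_norm g \<phi> \<le> 1 \<Longrightarrow>
      \<phi> \<in> disc_multipliers f \<and> disc_mult_norm f \<phi> \<le> ennreal C"
proof -
  obtain c where c: "0 < c" and eq: "disc_multipliers f = disc_multipliers g"
    and le: "\<And>\<phi>. \<phi> \<in> disc_multipliers f \<Longrightarrow> ennreal c * disc_mult_norm f \<phi> \<le> disc_mult_norm g \<phi>"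
    using assms unfolding equal_with_equivalent_norms_def by blast
  have "disc_mult_norm f \<phi> \<le> ennreal (1 / c)"
    if "\<phi> \<in> disc_multipliers g" "disc_mult_norm g \<phi> \<le> 1" for \<phi>
  proof -
    have "ennreal c * disc_mult_norm f \<phi> \<le> 1"
      using le[of \<phi>] that eq order_trans by blast
    then have "ennreal (1 / c) * (ennreal c * disc_mult_norm f \<phi>) \<le> ennreal (1 / c) * 1"
      by (rule mult_left_mono) simp
    moreover have "ennreal (1 / c) * ennreal c = 1"
      using c by (simp add: ennreal_mult[symmetric])
    ultimately show ?thesis
      by (simp add: mult.assoc[symmetric])
  qed
  then show thesis
    using that[of "1 / c"] c eq by simp
qed

theorem theorem3:
  fixes V :: "(complex ^ 'm) set" and W :: "(complex ^ 'n) set"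
    and f :: "complex \<Rightarrow> complex ^ 'm" and g :: "complex \<Rightarrow> complex ^ 'n"
  assumes "analytic_disc V" and "disc_embedding V f"
    and "analytic_disc W" and "disc_embedding W g"
    and "equal_with_equivalent_norms f g"
  shows "\<forall>\<xi>\<in>sphere 0 1. \<forall>\<zeta>\<in>sphere 0 1. f \<xi> = f \<zeta> \<longrightarrow>
           g \<xi> = g \<zeta> \<and> A_coeff f \<xi> / A_coeff f \<zeta> = A_coeff g \<xi> / A_coeff g \<zeta>"
proof (intro ballI impI)
  fix \<xi> \<zeta> :: complex
  assume \<xi>: "\<xi> \<in> sphere 0 1" and \<zeta>: "\<zeta> \<in> sphere 0 1" and eq: "f \<xi> = f \<zeta>"
  note f = assms(2) and g = assms(4)
  obtain \<alpha> where \<alpha>: "0 < \<alpha>" "A_coeff f \<xi> = of_real \<alpha>"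
    using A_coeff_pos[OF f \<xi>] .
  obtain \<alpha>' where \<alpha>': "0 < \<alpha>'" "A_coeff f \<zeta> = of_real \<alpha>'"
    using A_coeff_pos[OF f \<zeta>] .
  obtain \<beta> where \<beta>: "0 < \<beta>" "A_coeff g \<xi> = of_real \<beta>"
    using A_coeff_pos[OF g \<xi>] .
  obtain \<beta>' where \<beta>': "0 < \<beta>'" "A_coeff g \<zeta> = of_real \<beta>'"
    using A_coeff_pos[OF g \<zeta>] .
  \<comment> \<open>at this ratio of speeds the kernel functions at the images of the two radii align\<close>
  define c where "c = \<alpha> / \<alpha>'"
  have c: "0 < c"
    using \<alpha> \<alpha>' by (simp add: c_def)
  have cA: "of_real c * A_coeff f \<zeta> = A_coeff f \<xi>"
    using \<alpha> \<alpha>' by (simp add: c_def)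
  have q: "norm (g \<xi>) \<le> 1"
    using disc_embedding_sphere[OF g \<xi>] by simp
  obtain C where C: "0 < C"
    "\<And>\<phi>. \<phi> \<in> disc_multipliers g \<Longrightarrow> disc_mult_norm g \<phi> \<le> 1 \<Longrightarrow>
      \<phi> \<in> disc_multipliers f \<and> disc_mult_norm f \<phi> \<le> ennreal C"
    using equivalent_norms_bound[OF assms(5)] by blast
  \<comment> \<open>The factor \<open>1\<close> makes both radii instances of the expansion with a general rate.\<close>
  let ?z = "\<lambda>s. of_real (1 - 1 * s) * \<xi>" and ?w = "\<lambda>s. of_real (1 - c * s) * \<zeta>"
  let ?r = "\<lambda>u s. of_real s / (of_real (1 + s) - cinner (g (u s)) (g \<xi>))"
  let ?t = "\<lambda>s. kernel_cos2 (f (?z s)) (f (?w s))"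
  have "((\<lambda>s. C * (sqrt (1 - ?t s) + (1 - ?t s))) \<longlongrightarrow> C * (sqrt (1 - 1) + (1 - 1))) (at_right 0)"
    using kernel_cos2_tendsto_1[OF f \<xi> \<zeta> eq less_imp_le[OF c] \<alpha> cA] by (intro tendsto_intros) simp_all
  then have bound: "((\<lambda>s. C * (sqrt (1 - ?t s) + (1 - ?t s))) \<longlongrightarrow> 0) (at_right 0)"
    by simp
  have diff: "((\<lambda>s. ?r ?z s - ?r ?w s) \<longlongrightarrow> 0) (at_right 0)"
  proof (rule Lim_null_comparison[OF eventually_at_rightI bound])
    show "0 < min 1 (1 / c)"
      using c by simp
    fix s assume "s \<in> {0<..<min 1 (1 / c)}"
    then have s: "0 < s" "s < 1" "0 < c * s" "c * s < 1"
      using c by (auto simp: field_simps)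
    have ball: "?z s \<in> ball 0 1" "?w s \<in> ball 0 1"
      using s \<xi> \<zeta> by (simp_all add: norm_mult del: of_real_diff of_real_mult)
    let ?\<phi> = "pulled_back_resolvent g (g \<xi>) s"
    have val: "?\<phi> u = of_real s / (of_real (1 + s) - cinner (g u) (g \<xi>))" if "u \<in> ball 0 1" for u
      using that disc_embedding_ball[OF g that]
      by (simp add: pulled_back_resolvent_def resolvent_multiplier_def restrict0_def)
    have "?\<phi> \<in> disc_multipliers f \<and> disc_mult_norm f ?\<phi> \<le> ennreal C"
      using C(2)[OF pulled_back_resolvent_multiplier[OF g s(1) q]] .
    then show "cmod (?r ?z s - ?r ?w s) \<le> C * (sqrt (1 - ?t s) + (1 - ?t s))"
      using disc_multiplier_variation[OF f _ _ less_imp_le[OF C(1)] ball, of ?\<phi>]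
      unfolding val[OF ball(1)] val[OF ball(2)] by blast
  qed
  have nz: "1 + of_real (1::real) * A_coeff g \<xi> \<noteq> 0" "1 + of_real c * A_coeff g \<zeta> \<noteq> 0"
    unfolding \<beta>(2) \<beta>'(2) of_real_mult[symmetric] of_real_1[symmetric, where ?'a = complex]
      of_real_add[symmetric] of_real_eq_0_iff
    using \<beta>(1) \<beta>'(1) c add_pos_pos[of 1 "c * \<beta>'"] by auto
  have "(?r ?z \<longlongrightarrow> 1 / (1 + of_real 1 * A_coeff g \<xi>)) (at_right 0)"
    using resolvent_radial_limit[OF g \<xi> \<xi> refl zero_le_one nz(1)] .
  from tendsto_diff[OF this diff]
  have w_lim: "(?r ?w \<longlongrightarrow> 1 / (1 + A_coeff g \<xi>)) (at_right 0)"
    by simp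
  have crossing: "g \<xi> = g \<zeta>"
  proof (rule ccontr)
    assume "g \<xi> \<noteq> g \<zeta>"
    then have "(?r ?w \<longlongrightarrow> 0) (at_right 0)"
      using resolvent_limit_away[OF g \<xi> \<zeta> _ c] by simp
    then have "1 / (1 + A_coeff g \<xi>) = 0"
      using tendsto_unique[OF _ w_lim] by simp
    then show False
      using nz(1) by simp
  qed
  have "(?r ?w \<longlongrightarrow> 1 / (1 + of_real c * A_coeff g \<zeta>)) (at_right 0)"
    using resolvent_radial_limit[OF g \<xi> \<zeta> crossing less_imp_le[OF c] nz(2)] .
  then have "1 / (1 + A_coeff g \<xi>) = 1 / (1 + of_real c * A_coeff g \<zeta>)"
    using tendsto_unique[OF _ w_lim] by simp
  then have "A_coeff g \<xi> = of_real c * A_coeff g \<zeta>"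
    using nz by simp
  then show "g \<xi> = g \<zeta> \<and> A_coeff f \<xi> / A_coeff f \<zeta> = A_coeff g \<xi> / A_coeff g \<zeta>"
    using crossing \<alpha> \<alpha>' \<beta>' by (simp add: c_def)
qed

end
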